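(* Let $\mu$ be a complex-valued measure on $\mathbb{R}^d$ which has p-discrete support and belongs to $S^*(\mathbb{R}^d)$. Then its variation measure $|\mu|$ also belongs to $S^*(\mathbb{R}^d)$. In particular, every crystalline measure on $\mathbb{R}^d$ with p-discrete support and p-discrete spectrum is a Fourier quasicrystal.
   Context: $S(\mathbb{R}^d)$ is the Schwartz space and $S^*(\mathbb{R}^d)$ is the space of temperate (tempered) distributions, i.e. continuous linear functionals on $S(\mathbb{R}^d)$. The Fourier transform is $\hat\varphi(y)=\int_{\mathbb{R}^d}\varphi(x)e^{-2\pi i\langle x,y\rangle}dx$ on $S(\mathbb{R}^d)$ and $\hat f(\varphi)=f(\hat\varphi)$ on $S^*(\mathbb{R}^d)$. The spectrum of $f\in S^*(\mathbb{R}^d)$ is the support of $\hat f$. A set $A\subset\mathbb{R}^d$ is locally finite if its intersection with every ball is finite. A set $A\subset\mathbb{R}^d$ is polynomially discrete (p-discrete) if there are positive numbers $c,h$ such that $|x-x'|\ge c\min\{1,|x|^{-h}\}$ for all $x,x'\in A$, $x\ne x'$ (with $\min\{1,|x|^{-h}\}=1$ for $x=0$). A crystalline measure is an element $f\in S^*(\mathbb{R}^d)$ such that $f$ and $\hat f$ are complex-valued measures on $\mathbb{R}^d$ with locally finite supports. $|\mu|$ denotes the variation of a complex-valued measure $\mu$. A measure $\mu$ is a Fourier quasicrystal if both measures $|\mu|$ and $|\hat\mu|$ have locally finite supports and belong to $S^*(\mathbb{R}^d)$. *)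

theory Defs
  imports "HOL-Analysis.Analysis"
begin

text \<open>Multi-indices are encoded as lists of basis vectors; the list records the successive
  partial differentiations.\<close>

primrec partials :: "'a::euclidean_space list \<Rightarrow> ('a \<Rightarrow> complex) \<Rightarrow> 'a \<Rightarrow> complex" where
  "partials [] \<phi> = \<phi>"
| "partials (b # bs) \<phi> = (\<lambda>x. frechet_derivative (partials bs \<phi>) (at x) b)"

definition smooth :: "('a::euclidean_space \<Rightarrow> complex) \<Rightarrow> bool" where
  "smooth \<phi> \<longleftrightarrow> (\<forall>bs \<in> lists Basis. \<forall>x. partials bs \<phi> differentiable (at x))"

definition schwartz :: "('a::euclidean_space \<Rightarrow> complex) set" where
  "schwartz = {\<phi>. smooth \<phi> \<and>
     (\<forall>k::nat. \<forall>bs \<in> lists Basis. bdd_above (range (\<lambda>x. norm x ^ k * norm (partials bs \<phi> x))))}"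

definition schwartz_seminorm ::
    "nat \<Rightarrow> 'a::euclidean_space list \<Rightarrow> ('a \<Rightarrow> complex) \<Rightarrow> real" where
  "schwartz_seminorm k bs \<phi> = (SUP x. norm x ^ k * norm (partials bs \<phi> x))"

definition schwartz_topology :: "('a::euclidean_space \<Rightarrow> complex) topology" where
  "schwartz_topology = topology_generated_by
     {{\<psi> \<in> schwartz. schwartz_seminorm k bs (\<lambda>x. \<psi> x - \<phi> x) < e} | k bs \<phi> e.
        bs \<in> lists Basis \<and> \<phi> \<in> schwartz \<and> 0 < e}"

text \<open>Functionals are total functions in HOL; only their values on \<open>schwartz\<close> are meaningful.\<close>

definition tempered_distribution :: "(('a::euclidean_space \<Rightarrow> complex) \<Rightarrow> complex) \<Rightarrow> bool" where
  "tempered_distribution f \<longleftrightarrow>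
     (\<forall>\<phi> \<in> schwartz. \<forall>\<psi> \<in> schwartz. f (\<lambda>x. \<phi> x + \<psi> x) = f \<phi> + f \<psi>) \<and>
     (\<forall>c. \<forall>\<phi> \<in> schwartz. f (\<lambda>x. c * \<phi> x) = c * f \<phi>) \<and>
     continuous_map schwartz_topology euclidean f"

definition fourier :: "('a::euclidean_space \<Rightarrow> complex) \<Rightarrow> 'a \<Rightarrow> complex" where
  "fourier \<phi> y = (LINT x|lborel. \<phi> x * exp (- 2 * of_real pi * \<i> * of_real (x \<bullet> y)))"

definition dist_fourier ::
    "(('a::euclidean_space \<Rightarrow> complex) \<Rightarrow> complex) \<Rightarrow> ('a \<Rightarrow> complex) \<Rightarrow> complex" where
  "dist_fourier f \<phi> = f (fourier \<phi>)"

definition test_function :: "('a::euclidean_space \<Rightarrow> complex) \<Rightarrow> bool" where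
  "test_function \<phi> \<longleftrightarrow> smooth \<phi> \<and> compact (closure {x. \<phi> x \<noteq> 0})"

definition dist_support :: "(('a::euclidean_space \<Rightarrow> complex) \<Rightarrow> complex) \<Rightarrow> 'a set" where
  "dist_support f = - \<Union>{U. open U \<and>
     (\<forall>\<phi>. test_function \<phi> \<and> closure {x. \<phi> x \<noteq> 0} \<subseteq> U \<longrightarrow> f \<phi> = 0)}"

definition spectrum :: "(('a::euclidean_space \<Rightarrow> complex) \<Rightarrow> complex) \<Rightarrow> 'a set" where
  "spectrum f = dist_support (dist_fourier f)"

text \<open>Measures need not be finite, so a complex-valued measure is a countably additive set
  function on the bounded Borel sets; its values on all other sets are irrelevant.\<close>

definition complex_measure :: "('a::euclidean_space set \<Rightarrow> complex) \<Rightarrow> bool" where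
  "complex_measure \<mu> \<longleftrightarrow>
     (\<forall>A::nat \<Rightarrow> 'a set. range A \<subseteq> sets borel \<and> disjoint_family A \<and> bounded (\<Union>i. A i)
        \<longrightarrow> (\<lambda>i. \<mu> (A i)) sums \<mu> (\<Union>i. A i))"

text \<open>The variation is again represented as a set function on the bounded Borel sets. The supremum
  over finite Borel partitions is finite there for every complex-valued measure.\<close>

definition variation :: "('a::euclidean_space set \<Rightarrow> complex) \<Rightarrow> 'a set \<Rightarrow> complex" where
  "variation \<mu> E = complex_of_real
     (SUP P \<in> {P. finite P \<and> disjoint P \<and> P \<subseteq> sets borel \<and> \<Union>P = E}. \<Sum>B\<in>P. norm (\<mu> B))"

definition measure_support :: "('a::euclidean_space set \<Rightarrow> complex) \<Rightarrow> 'a set" where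
  "measure_support \<mu> = - \<Union>{U. open U \<and>
     (\<forall>E. E \<in> sets borel \<and> bounded E \<and> E \<subseteq> U \<longrightarrow> \<mu> E = 0)}"

text \<open>The positive part in the Jordan decomposition of a real-valued \<open>\<nu>\<close>, as a Borel measure on the
  whole space. The competitor \<open>B = {}\<close> makes the truncation of negative values by \<open>ennreal\<close>
  harmless.\<close>

definition upper_variation :: "('a::euclidean_space set \<Rightarrow> real) \<Rightarrow> 'a measure" where
  "upper_variation \<nu> = measure_of UNIV (sets borel)
     (\<lambda>E. SUP B \<in> {B \<in> sets borel. bounded B \<and> B \<subseteq> E}. ennreal (\<nu> B))"

definition complex_integral ::
    "('a::euclidean_space set \<Rightarrow> complex) \<Rightarrow> ('a \<Rightarrow> complex) \<Rightarrow> complex" where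
  "complex_integral \<mu> \<phi> =
     (LINT x|upper_variation (\<lambda>E. Re (\<mu> E)). \<phi> x) - (LINT x|upper_variation (\<lambda>E. - Re (\<mu> E)). \<phi> x)
     + \<i> * ((LINT x|upper_variation (\<lambda>E. Im (\<mu> E)). \<phi> x)
            - (LINT x|upper_variation (\<lambda>E. - Im (\<mu> E)). \<phi> x))"

text \<open>A distribution is a measure if the two agree as functionals on compactly supported smooth
  functions; no absolute convergence of the integrals of Schwartz functions is required.\<close>

definition is_measure ::
    "(('a::euclidean_space \<Rightarrow> complex) \<Rightarrow> complex) \<Rightarrow> ('a set \<Rightarrow> complex) \<Rightarrow> bool" where
  "is_measure f \<mu> \<longleftrightarrow> complex_measure \<mu> \<and> (\<forall>\<phi>. test_function \<phi> \<longrightarrow> f \<phi> = complex_integral \<mu> \<phi>)"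

definition tempered_measure :: "('a::euclidean_space set \<Rightarrow> complex) \<Rightarrow> bool" where
  "tempered_measure \<mu> \<longleftrightarrow> (\<exists>f. tempered_distribution f \<and> is_measure f \<mu>)"

definition locally_finite :: "'a::euclidean_space set \<Rightarrow> bool" where
  "locally_finite A \<longleftrightarrow> (\<forall>x r. finite (A \<inter> ball x r))"

definition p_discrete :: "'a::euclidean_space set \<Rightarrow> bool" where
  "p_discrete A \<longleftrightarrow> (\<exists>c > 0. \<exists>h > 0. \<forall>x \<in> A. \<forall>x' \<in> A. x \<noteq> x' \<longrightarrow>
     norm (x - x') \<ge> c * (if x = 0 then 1 else min 1 (norm x powr (- h))))"

definition crystalline_measure :: "(('a::euclidean_space \<Rightarrow> complex) \<Rightarrow> complex) \<Rightarrow> bool" where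
  "crystalline_measure f \<longleftrightarrow> tempered_distribution f \<and>
     (\<exists>\<mu> \<nu>. is_measure f \<mu> \<and> locally_finite (measure_support \<mu>) \<and>
            is_measure (dist_fourier f) \<nu> \<and> locally_finite (measure_support \<nu>))"

text \<open>The measures \<open>\<mu>\<close> and \<open>\<nu>\<close> are determined by \<open>f\<close> on bounded Borel sets, so the existential
  quantifiers here and above merely give names to \<open>f\<close> and its Fourier transform as measures.\<close>

definition fourier_quasicrystal :: "(('a::euclidean_space \<Rightarrow> complex) \<Rightarrow> complex) \<Rightarrow> bool" where
  "fourier_quasicrystal f \<longleftrightarrow> tempered_distribution f \<and>
     (\<exists>\<mu> \<nu>. is_measure f \<mu> \<and> is_measure (dist_fourier f) \<nu> \<and>
            locally_finite (measure_support (variation \<mu>)) \<and> tempered_measure (variation \<mu>) \<and>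
            locally_finite (measure_support (variation \<nu>)) \<and> tempered_measure (variation \<nu>))"

end

theory Submission imports Defs begin

text \<open>Test a measure with p-discrete support against smooth bumps \<open>\<phi>\<^sub>x\<close> about the points \<open>x\<close> of the support,
  of radius \<open>c (1 + |x|)\<^sup>-\<^sup>N\<close>, so that \<open>\<phi>\<^sub>x\<close> sees no other point of the support. The Schwartz seminorms
  of \<open>\<phi>\<^sub>x\<close>, and those of its Fourier transform, grow polynomially in \<open>x\<close>; hence so does the mass of the
  atom at \<open>x\<close> as soon as the measure, or its inverse Fourier transform, is tempered. Since a p-discrete
  set has only polynomially many points in a ball, the sum of the moduli of the atoms against a
  Schwartz function converges absolutely and is continuous in the Schwartz topology.\<close>

subsection \<open>Functions of polynomial growth\<close>

text \<open>A distribution that is a measure is only known to agree with it on smooth functions of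
  compact support, so an atom has to be read off by such functions. They shrink as \<open>x\<close>
  moves away, and every derivative costs powers of \<open>1 / \<epsilon> x\<close>; a continuity
  estimate is of use only if each seminorm of the whole family grows polynomially in
  \<open>x\<close>. The objects of the proof are therefore families indexed by \<open>x\<close>,
  taken from a class that is stable under differentiation and under multiplication by coordinates.

  The same class settles the Fourier side. If \<open>\<nu>\<close> represents
  \<open>dist_fourier f\<close>, its atoms are values of \<open>f\<close> at transforms of bumps. Up
  to constants, differentiating a transform multiplies the bump by a coordinate, and multiplying a
  transform by a coordinate differentiates the bump, so the transforms inherit polynomial bounds.
  Continuity of the Fourier transform on the whole Schwartz space is thereby bypassed.\<close>

definition moderate :: "('a::real_normed_vector \<Rightarrow> real) \<Rightarrow> bool" where
  "moderate a \<longleftrightarrow> (\<exists>C N. \<forall>x. a x \<le> C * (1 + norm x) ^ N)"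

text \<open>Normal form of the bound: a positive constant and any sufficiently large exponent, so
  that two bounds can be brought to a common exponent and added, or multiplied.\<close>

lemma moderate_dominated:
  assumes "moderate a"
  shows "\<exists>C N. C > 0 \<and> (\<forall>x M. M \<ge> N \<longrightarrow> a x \<le> C * (1 + norm x) ^ M)"
proof -
  obtain C N where CN: "\<And>x. a x \<le> C * (1 + norm x) ^ N"
    using assms unfolding moderate_def by blast
  have *: "a x \<le> (\<bar>C\<bar> + 1) * (1 + norm x) ^ M" if "M \<ge> N" for x M
  proof -
    have "C * (1 + norm x) ^ N \<le> (\<bar>C\<bar> + 1) * (1 + norm x) ^ N"
      by (intro mult_right_mono) auto
    also have "\<dots> \<le> (\<bar>C\<bar> + 1) * (1 + norm x) ^ M"
      by (intro mult_left_mono power_increasing that) auto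
    finally show ?thesis using CN[of x] by linarith
  qed
  then show ?thesis
    by (intro exI[of _ "\<bar>C\<bar> + 1"] exI[of _ N]) auto
qed

lemma moderateI: "(\<And>x. a x \<le> C * (1 + norm x) ^ N) \<Longrightarrow> moderate a"
  unfolding moderate_def by blast

lemma moderate_mono: "moderate b \<Longrightarrow> (\<And>x. a x \<le> b x) \<Longrightarrow> moderate a"
  unfolding moderate_def by (meson order_trans)

lemma moderate_const: "moderate (\<lambda>x. c)"
  by (rule moderateI[of _ c 0]) simp

lemma moderate_norm: "moderate (\<lambda>x. norm x)"
  by (rule moderateI[of _ 1 1]) simp

lemma moderate_add:
  assumes "moderate a" "moderate b" shows "moderate (\<lambda>x. a x + b x)"
proof -
  obtain C N where "C > 0" and 1: "\<And>x M. M \<ge> N \<Longrightarrow> a x \<le> C * (1 + norm x) ^ M"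
    using moderate_dominated[OF assms(1)] by blast
  obtain C' N' where "C' > 0" and 2: "\<And>x M. M \<ge> N' \<Longrightarrow> b x \<le> C' * (1 + norm x) ^ M"
    using moderate_dominated[OF assms(2)] by blast
  show ?thesis
    by (rule moderateI[of _ "C + C'" "max N N'"])
      (metis 1 2 add_mono distrib_right max.cobounded1 max.cobounded2)
qed

lemma moderate_mult:
  assumes "moderate a" "moderate b" "\<And>x. 0 \<le> a x" "\<And>x. 0 \<le> b x"
  shows "moderate (\<lambda>x. a x * b x)"
proof -
  obtain C N where 1: "C > 0" "\<And>x M. M \<ge> N \<Longrightarrow> a x \<le> C * (1 + norm x) ^ M"
    using moderate_dominated[OF assms(1)] by blast
  obtain C' N' where 2: "C' > 0" "\<And>x M. M \<ge> N' \<Longrightarrow> b x \<le> C' * (1 + norm x) ^ M"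
    using moderate_dominated[OF assms(2)] by blast
  have "a x * b x \<le> (C * C') * (1 + norm x) ^ (N + N')" for x
  proof -
    have "a x * b x \<le> (C * (1 + norm x) ^ N) * (C' * (1 + norm x) ^ N')"
      using 1 2 assms(3,4) by (intro mult_mono) auto
    then show ?thesis by (simp add: power_add mult_ac)
  qed
  then show ?thesis by (rule moderateI)
qed

lemma moderate_power:
  assumes "moderate a" "\<And>x. 0 \<le> a x"
  shows "moderate (\<lambda>x. a x ^ k)"
  by (induction k) (simp_all add: moderate_const moderate_mult assms)

lemma moderate_sum:
  assumes "\<And>i. i \<in> I \<Longrightarrow> moderate (a i)"
  shows "moderate (\<lambda>x. \<Sum>i\<in>I. a i x)"
  using assms by (induction I rule: infinite_finite_induct) (simp_all add: moderate_const moderate_add)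

subsection \<open>Schwartz seminorms\<close>

lemma partials_add:
  assumes "smooth \<phi>" "smooth \<psi>" "bs \<in> lists Basis"
  shows "partials bs (\<lambda>x. \<phi> x + \<psi> x) = (\<lambda>x. partials bs \<phi> x + partials bs \<psi> x)"
  using assms(3)
proof (induction bs)
  case (Cons b bs)
  then have "bs \<in> lists Basis" by auto
  then have "partials bs \<phi> differentiable (at x)" "partials bs \<psi> differentiable (at x)" for x
    using assms unfolding smooth_def by auto
  then show ?case
    using Cons.IH
    by (auto intro!: fun_cong[OF frechet_derivative_at[symmetric, OF has_derivative_add]]
        simp: frechet_derivative_works[symmetric])
qed simp

lemma partials_cmult:
  assumes "smooth \<phi>" "bs \<in> lists Basis"
  shows "partials bs (\<lambda>x. c * \<phi> x) = (\<lambda>x. c * partials bs \<phi> x)"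
  using assms(2)
proof (induction bs)
  case (Cons b bs)
  then have "bs \<in> lists Basis" by auto
  then have "partials bs \<phi> differentiable (at x)" for x
    using assms unfolding smooth_def by auto
  then show ?case
    using Cons.IH
    by (auto intro!: fun_cong[OF frechet_derivative_at[symmetric, OF has_derivative_mult_right]]
        simp: frechet_derivative_works[symmetric])
qed simp

lemma smooth_cmult: "smooth \<phi> \<Longrightarrow> smooth (\<lambda>x. c * \<phi> x)"
  unfolding smooth_def[of "\<lambda>x. c * \<phi> x"]
  by (auto simp: partials_cmult smooth_def intro!: derivative_intros)

lemma smooth_add: "smooth \<phi> \<Longrightarrow> smooth \<psi> \<Longrightarrow> smooth (\<lambda>x. \<phi> x + \<psi> x)"
  unfolding smooth_def[of "\<lambda>x. \<phi> x + \<psi> x"]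
  by (auto simp: partials_add smooth_def intro!: derivative_intros)

lemma smooth_continuous_on: "smooth \<phi> \<Longrightarrow> continuous_on A \<phi>"
  unfolding smooth_def
  by (metis continuous_at_imp_continuous_on differentiable_imp_continuous_within lists.Nil partials.simps(1))

lemma schwartz_bdd:
  "\<phi> \<in> schwartz \<Longrightarrow> bs \<in> lists Basis \<Longrightarrow> bdd_above (range (\<lambda>x. norm x ^ k * norm (partials bs \<phi> x)))"
  unfolding schwartz_def by auto

lemma schwartz_smooth: "\<phi> \<in> schwartz \<Longrightarrow> smooth \<phi>"
  unfolding schwartz_def by auto

lemma schwartz_seminorm_upper:
  "\<phi> \<in> schwartz \<Longrightarrow> bs \<in> lists Basis \<Longrightarrow>
    norm x ^ k * norm (partials bs \<phi> x) \<le> schwartz_seminorm k bs \<phi>"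
  unfolding schwartz_seminorm_def by (intro cSUP_upper schwartz_bdd) auto

lemma schwartz_seminorm_nonneg:
  "\<phi> \<in> schwartz \<Longrightarrow> bs \<in> lists Basis \<Longrightarrow> 0 \<le> schwartz_seminorm k bs \<phi>"
  by (rule order_trans[OF _ schwartz_seminorm_upper[where x=0]]) auto

lemma schwartzI:
  assumes "smooth \<phi>"
    and "\<And>k bs x. bs \<in> lists Basis \<Longrightarrow> norm x ^ k * norm (partials bs \<phi> x) \<le> B k bs"
  shows "\<phi> \<in> schwartz"
  unfolding schwartz_def using assms by (auto intro!: bdd_aboveI)

lemma schwartz_add:
  assumes "\<phi> \<in> schwartz" "\<psi> \<in> schwartz"
  shows "(\<lambda>x. \<phi> x + \<psi> x) \<in> schwartz"
    and schwartz_seminorm_add: "bs \<in> lists Basis \<Longrightarrow>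
      schwartz_seminorm k bs (\<lambda>x. \<phi> x + \<psi> x) \<le> schwartz_seminorm k bs \<phi> + schwartz_seminorm k bs \<psi>"
proof -
  have *: "norm x ^ k * norm (partials bs (\<lambda>x. \<phi> x + \<psi> x) x)
      \<le> schwartz_seminorm k bs \<phi> + schwartz_seminorm k bs \<psi>" if bs: "bs \<in> lists Basis" for k bs x
  proof -
    have "norm x ^ k * norm (partials bs (\<lambda>x. \<phi> x + \<psi> x) x)
        \<le> norm x ^ k * (norm (partials bs \<phi> x) + norm (partials bs \<psi> x))"
      unfolding partials_add[OF schwartz_smooth[OF assms(1)] schwartz_smooth[OF assms(2)] bs]
      by (intro mult_left_mono norm_triangle_ineq) auto
    then show ?thesis
      using schwartz_seminorm_upper[OF assms(1) bs, of x k] schwartz_seminorm_upper[OF assms(2) bs, of x k]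
      by (simp add: distrib_left)
  qed
  show "(\<lambda>x. \<phi> x + \<psi> x) \<in> schwartz"
    by (rule schwartzI, intro smooth_add schwartz_smooth assms, rule *)
  show "schwartz_seminorm k bs (\<lambda>x. \<phi> x + \<psi> x) \<le> schwartz_seminorm k bs \<phi> + schwartz_seminorm k bs \<psi>"
    if "bs \<in> lists Basis"
    unfolding schwartz_seminorm_def[of k bs "\<lambda>x. \<phi> x + \<psi> x"]
    using *[OF that] by (intro cSUP_least) auto
qed

lemma schwartz_cmult:
  assumes "\<phi> \<in> schwartz"
  shows "(\<lambda>x. c * \<phi> x) \<in> schwartz"
    and schwartz_seminorm_cmult: "bs \<in> lists Basis \<Longrightarrow>
      schwartz_seminorm k bs (\<lambda>x. c * \<phi> x) \<le> norm c * schwartz_seminorm k bs \<phi>"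
proof -
  have *: "norm x ^ k * norm (partials bs (\<lambda>x. c * \<phi> x) x)
      \<le> norm c * schwartz_seminorm k bs \<phi>" if bs: "bs \<in> lists Basis" for k bs x
    unfolding partials_cmult[OF schwartz_smooth[OF assms] bs]
    using mult_left_mono[OF schwartz_seminorm_upper[OF assms bs, of x k], of "norm c"]
    by (simp add: norm_mult mult_ac)
  show "(\<lambda>x. c * \<phi> x) \<in> schwartz"
    by (rule schwartzI, intro smooth_cmult schwartz_smooth assms, rule *)
  show "schwartz_seminorm k bs (\<lambda>x. c * \<phi> x) \<le> norm c * schwartz_seminorm k bs \<phi>"
    if "bs \<in> lists Basis"
    unfolding schwartz_seminorm_def[of k bs "\<lambda>x. c * \<phi> x"]
    using *[OF that] by (intro cSUP_least) auto
qed

lemma partials_zero: "partials bs (\<lambda>x. 0) = (\<lambda>x. 0)"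
  by (induction bs) (auto simp: frechet_derivative_const)

lemma schwartz_zero: "(\<lambda>x. 0) \<in> schwartz"
  by (rule schwartzI[of _ "\<lambda>_ _. 0"]) (auto simp: smooth_def partials_zero)

lemma schwartz_diff: "\<phi> \<in> schwartz \<Longrightarrow> \<psi> \<in> schwartz \<Longrightarrow> (\<lambda>x. \<phi> x - \<psi> x) \<in> schwartz"
  using schwartz_add(1)[OF _ schwartz_cmult(1)[of \<psi> "-1"]] by simp

lemma schwartz_seminorm_zero: "schwartz_seminorm k bs (\<lambda>x. 0) = 0"
  by (simp add: schwartz_seminorm_def partials_zero)

section \<open>Neighbourhoods of zero in the Schwartz topology and bounds for continuous
  functionals\<close>

lemma openin_schwartz_seminorm:
  assumes "bs \<in> lists Basis" "\<phi> \<in> schwartz" "0 < e"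
  shows "openin schwartz_topology {\<psi> \<in> schwartz. schwartz_seminorm k bs (\<lambda>x. \<psi> x - \<phi> x) < e}"
  unfolding schwartz_topology_def using assms by (intro topology_generated_by_Basis) blast

lemma topspace_schwartz: "topspace (schwartz_topology :: ('a::euclidean_space \<Rightarrow> complex) topology) = schwartz"
proof (rule equalityI)
  show "topspace schwartz_topology \<subseteq> (schwartz :: ('a \<Rightarrow> complex) set)"
    unfolding schwartz_topology_def topology_generated_by_topspace by blast
  show "(schwartz :: ('a \<Rightarrow> complex) set) \<subseteq> topspace schwartz_topology"
  proof
    fix \<phi> :: "'a \<Rightarrow> complex" assume "\<phi> \<in> schwartz"
    then show "\<phi> \<in> topspace schwartz_topology"
      using openin_subset[OF openin_schwartz_seminorm[OF lists.Nil \<open>\<phi> \<in> schwartz\<close> zero_less_one, of 0]]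
      by (auto simp: schwartz_seminorm_zero)
  qed
qed

text \<open>The subbasic sets are seminorm balls about arbitrary centres \<open>\<phi>\<close>. By
  the triangle inequality such a ball, if it contains 0, contains the ball about 0 whose radius is
  \<open>e\<close> minus the seminorm of \<open>- \<phi>\<close>. Finite intersections only enlarge
  \<open>I\<close> and shrink \<open>\<delta>\<close>.\<close>

lemma schwartz_nhd_zero:
  assumes "openin schwartz_topology U" "(\<lambda>x. 0) \<in> U"
  shows "\<exists>I \<delta>. finite I \<and> I \<subseteq> UNIV \<times> lists Basis \<and> \<delta> > 0 \<and>
    (\<forall>\<psi> \<in> schwartz. (\<forall>(k, bs) \<in> I. schwartz_seminorm k bs \<psi> < \<delta>) \<longrightarrow> \<psi> \<in> U)"
proof -
  define Q where "Q U I \<delta> \<longleftrightarrow> finite I \<and> I \<subseteq> UNIV \<times> lists Basis \<and> \<delta> > 0 \<and>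
    (\<forall>\<psi> \<in> schwartz. (\<forall>(k, bs) \<in> I. schwartz_seminorm k bs \<psi> < \<delta>) \<longrightarrow> \<psi> \<in> U)"
    for U :: "('a \<Rightarrow> complex) set" and I and \<delta> :: real
  have "generate_topology_on {{\<psi> \<in> schwartz. schwartz_seminorm k bs (\<lambda>x. \<psi> x - \<phi> x) < e} | k bs \<phi> e.
        bs \<in> lists Basis \<and> \<phi> \<in> schwartz \<and> 0 < e} U"
    using assms(1) unfolding schwartz_topology_def by (rule openin_topology_generated_by)
  then have "\<exists>I \<delta>. Q U I \<delta>" using assms(2)
  proof induction
    case (Int U V)
    then obtain I \<delta> J \<eta> where "Q U I \<delta>" "Q V J \<eta>" by blast
    then have "Q (U \<inter> V) (I \<union> J) (min \<delta> \<eta>)"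
      unfolding Q_def by fastforce
    then show ?case by blast
  next
    case (UN K)
    then obtain V I \<delta> where "V \<in> K" "Q V I \<delta>" by blast
    then have "Q (\<Union>K) I \<delta>" unfolding Q_def by blast
    then show ?case by blast
  next
    case (Basis V)
    then obtain k bs \<phi> e where V: "V = {\<psi> \<in> schwartz. schwartz_seminorm k bs (\<lambda>x. \<psi> x - \<phi> x) < e}"
      and *: "bs \<in> lists Basis" "\<phi> \<in> schwartz" "0 < e" by blast
    let ?n = "\<lambda>x. 0 - \<phi> x"
    have n: "?n \<in> schwartz" by (intro schwartz_diff schwartz_zero *)
    have "schwartz_seminorm k bs ?n < e" using Basis V by auto
    moreover have "\<psi> \<in> V" if "\<psi> \<in> schwartz" "schwartz_seminorm k bs \<psi> < e - schwartz_seminorm k bs ?n" for \<psi>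
      using schwartz_seminorm_add[OF that(1) n *(1), of k] that unfolding V by simp
    ultimately have "Q V {(k, bs)} (e - schwartz_seminorm k bs ?n)"
      using * unfolding Q_def by auto
    then show ?case by blast
  qed simp
  then show ?thesis unfolding Q_def .
qed

text \<open>Continuity at 0 makes \<open>norm (f \<psi>) < 1\<close> once finitely many seminorms of
  \<open>\<psi>\<close> are below \<open>\<delta>\<close>; homogeneity turns this into a bound of
  \<open>norm (f \<psi>)\<close> by those seminorms, and the same seminorms serve every
  \<open>x\<close>.\<close>

lemma tempered_distribution_moderate:
  assumes f: "tempered_distribution f"
    and \<Phi>: "\<And>x. \<Phi> x \<in> schwartz"
    and mod: "\<And>k bs. bs \<in> lists Basis \<Longrightarrow> moderate (\<lambda>x. schwartz_seminorm k bs (\<Phi> x))"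
  shows "moderate (\<lambda>x. norm (f (\<Phi> x)))"
proof -
  have scale: "\<And>c \<phi>. \<phi> \<in> schwartz \<Longrightarrow> f (\<lambda>x. c * \<phi> x) = c * f \<phi>"
    and cont: "continuous_map schwartz_topology euclidean f"
    using f unfolding tempered_distribution_def by auto
  have "f (\<lambda>x. 0) = 0" using scale[OF schwartz_zero, of 0] by simp
  moreover have "openin schwartz_topology {\<psi> \<in> schwartz. f \<psi> \<in> ball 0 1}"
    using openin_continuous_map_preimage[OF cont, of "ball 0 1"] by (simp add: topspace_schwartz)
  ultimately have "\<exists>I \<delta>. finite I \<and> I \<subseteq> UNIV \<times> lists Basis \<and> \<delta> > 0 \<and>
      (\<forall>\<psi> \<in> schwartz. (\<forall>(k, bs) \<in> I. schwartz_seminorm k bs \<psi> < \<delta>)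
        \<longrightarrow> \<psi> \<in> {\<psi> \<in> schwartz. f \<psi> \<in> ball 0 1})"
    by (intro schwartz_nhd_zero) (auto simp: schwartz_zero)
  then obtain I \<delta> where I: "finite I" "I \<subseteq> UNIV \<times> lists Basis" and \<delta>: "\<delta> > 0"
    and U: "\<And>\<psi>. \<psi> \<in> schwartz \<Longrightarrow> \<forall>(k, bs) \<in> I. schwartz_seminorm k bs \<psi> < \<delta> \<Longrightarrow> norm (f \<psi>) < 1"
    by (auto simp: dist_norm)
  \<comment> \<open>The summand 1 keeps \<open>s\<close> positive when all the seminorms vanish, and
    makes each of them strictly smaller than \<open>s\<close>.\<close>
  define s where "s x = 1 + (\<Sum>(k, bs)\<in>I. schwartz_seminorm k bs (\<Phi> x))" for x
  have nn: "0 \<le> schwartz_seminorm k bs (\<Phi> x)" if "(k, bs) \<in> I" for k bs x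
    using that I by (intro schwartz_seminorm_nonneg \<Phi>) auto
  have s1: "s x \<ge> 1" for x
    unfolding s_def using nn by (auto intro!: sum_nonneg)
  have le: "schwartz_seminorm k bs (\<Phi> x) < s x" if "(k, bs) \<in> I" for k bs x
  proof -
    have "(case (k, bs) of (k, bs) \<Rightarrow> schwartz_seminorm k bs (\<Phi> x))
        \<le> (\<Sum>(k, bs)\<in>I. schwartz_seminorm k bs (\<Phi> x))"
      using that I nn by (intro member_le_sum) auto
    then show ?thesis unfolding s_def by simp
  qed
  have "norm (f (\<Phi> x)) \<le> s x / \<delta>" for x
  proof -
    have s0: "s x > 0" using s1[of x] by linarith
    define c where "c = complex_of_real (\<delta> / s x)"
    have nc: "norm c = \<delta> / s x" using \<delta> s0 by (simp add: c_def norm_divide)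
    have "schwartz_seminorm k bs (\<lambda>y. c * \<Phi> x y) < \<delta>" if "(k, bs) \<in> I" for k bs
    proof -
      have "schwartz_seminorm k bs (\<lambda>y. c * \<Phi> x y) \<le> norm c * schwartz_seminorm k bs (\<Phi> x)"
        using that I by (intro schwartz_seminorm_cmult \<Phi>) auto
      also have "\<dots> < norm c * s x"
        using le[OF that] \<delta> s0 by (intro mult_strict_left_mono) (auto simp: nc)
      also have "\<dots> = \<delta>" using s0 by (simp add: nc)
      finally show ?thesis .
    qed
    then have "norm (f (\<lambda>y. c * \<Phi> x y)) < 1"
      by (intro U schwartz_cmult \<Phi>) auto
    then have "\<delta> / s x * norm (f (\<Phi> x)) < 1" by (simp add: scale \<Phi> norm_mult nc)
    then show ?thesis using \<delta> s0 by (simp add: field_simps)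
  qed
  moreover have "moderate (\<lambda>x. s x / \<delta>)"
  proof -
    have "moderate (\<lambda>x. \<Sum>(k, bs)\<in>I. schwartz_seminorm k bs (\<Phi> x))"
      using I(2) by (intro moderate_sum) (auto intro!: mod)
    then have "moderate (\<lambda>x. s x * (1 / \<delta>))"
      unfolding s_def[abs_def] using \<delta> nn 
      by (intro moderate_mult moderate_add moderate_const) (auto intro!: add_nonneg_nonneg sum_nonneg)
    then show ?thesis by simp
  qed
  ultimately show ?thesis by (rule moderate_mono[rotated])
qed

subsection \<open>Discrete measures\<close>

lemma measure_support_closed: "closed (measure_support \<mu>)"
  unfolding measure_support_def by auto

lemma complex_measure_empty:
  assumes "complex_measure \<mu>" shows "\<mu> {} = 0"
proof -
  have "(\<lambda>i::nat. \<mu> {}) sums \<mu> {}"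
    using assms[unfolded complex_measure_def, rule_format, of "\<lambda>_. {}"]
    by (auto simp: disjoint_family_on_def)
  then have "(\<lambda>i::nat. \<mu> {}) \<longlonglongrightarrow> 0" by (intro summable_LIMSEQ_zero) (auto simp: sums_iff)
  then show ?thesis by (simp add: LIMSEQ_const_iff)
qed

lemma complex_measure_Un:
  assumes "complex_measure \<mu>" "A \<in> sets borel" "B \<in> sets borel" "A \<inter> B = {}" "bounded A" "bounded B"
  shows "\<mu> (A \<union> B) = \<mu> A + \<mu> B"
proof -
  let ?A = "binaryset A B"
  have "(\<lambda>i. \<mu> (?A i)) sums \<mu> (\<Union>i. ?A i)"
    using assms
    by (intro assms(1)[unfolded complex_measure_def, rule_format])
      (auto simp: UN_binaryset_eq range_binaryset_eq binaryset_def disjoint_family_on_def)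
  moreover have "(\<lambda>i. \<mu> (?A i)) sums (\<mu> A + \<mu> B)"
    by (intro binaryset_sums complex_measure_empty[OF assms(1)])
  ultimately show ?thesis by (simp add: UN_binaryset_eq sums_iff)
qed

text \<open>The complement of the support is a union of possibly uncountably many null open sets.
  Lindelof leaves countably many, and cutting them into disjoint pieces makes countable additivity
  applicable.\<close>

lemma complex_measure_null_off_support:
  assumes \<mu>: "complex_measure \<mu>" and E: "E \<in> sets borel" "bounded E" "E \<inter> measure_support \<mu> = {}"
  shows "\<mu> E = 0"
proof -
  define \<U> where "\<U> = {U. open U \<and> (\<forall>E. E \<in> sets borel \<and> bounded E \<and> E \<subseteq> U \<longrightarrow> \<mu> E = 0)}"
  obtain \<V> where \<V>: "\<V> \<subseteq> \<U>" "countable \<V>" "\<Union>\<V> = \<Union>\<U>"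
    using Lindelof[of \<U>] unfolding \<U>_def by blast
  have EU: "E \<subseteq> \<Union>\<V>" using E(3) \<V>(3) unfolding measure_support_def \<U>_def by blast
  show ?thesis
  proof (cases "\<V> = {}")
    case True
    then show ?thesis using EU complex_measure_empty[OF \<mu>] by simp
  next
    case False
    define U where "U = from_nat_into \<V>"
    have U: "range U = \<V>" unfolding U_def by (rule range_from_nat_into[OF False \<V>(2)])
    let ?D = "\<lambda>n::nat. disjointed (\<lambda>n. E \<inter> U n) n"
    have UU: "U n \<in> \<U>" for n using U \<V>(1) by auto
    then have "open (U n)" for n by (simp add: \<U>_def)
    then have Ub: "E \<inter> U n \<in> sets borel" for n using E(1) by auto
    then have D: "range ?D \<subseteq> sets borel"
      by (intro sets.range_disjointed_sets) auto
    have Dsub: "?D n \<subseteq> E \<inter> U n" for n by (rule disjointed_subset)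
    have un: "(\<Union>n. ?D n) = E"
      using EU U unfolding UN_disjointed_eq by auto
    have "\<mu> (?D n) = 0" for n
      using UU[of n] Dsub[of n] D bounded_subset[OF E(2)] unfolding \<U>_def by blast
    moreover have "(\<lambda>n. \<mu> (?D n)) sums \<mu> (\<Union>n. ?D n)"
      using D E(2) un by (intro \<mu>[unfolded complex_measure_def, rule_format]) (auto simp: disjoint_family_disjointed)
    ultimately show ?thesis
      unfolding un by (simp add: sums_iff)
  qed
qed

lemma locally_finite_Int_bounded:
  assumes "locally_finite S" "bounded E" shows "finite (E \<inter> S)"
proof -
  obtain r where "E \<subseteq> ball 0 r" using assms(2) bounded_subset_ballD by blast
  then have "E \<inter> S \<subseteq> S \<inter> ball 0 r" by auto
  then show ?thesis using assms(1) finite_subset unfolding locally_finite_def by blast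
qed

text \<open>\<open>m\<close> is the discrete measure \<open>\<Sum>x\<in>S. w x \<delta>\<^sub>x\<close>, as a set function on the bounded Borel sets.\<close>

definition discrete_on :: "'a::euclidean_space set \<Rightarrow> ('a \<Rightarrow> 'b::comm_monoid_add) \<Rightarrow> ('a set \<Rightarrow> 'b) \<Rightarrow> bool" where
  "discrete_on S w m \<longleftrightarrow> (\<forall>E. E \<in> sets borel \<and> bounded E \<longrightarrow> m E = (\<Sum>x\<in>E \<inter> S. w x))"

lemma discrete_onD:
  "discrete_on S w m \<Longrightarrow> E \<in> sets borel \<Longrightarrow> bounded E \<Longrightarrow> m E = (\<Sum>x\<in>E \<inter> S. w x)"
  unfolding discrete_on_def by blast

text \<open>A bounded set meets the support in finitely many points, and the rest of the set is
  null.\<close>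

lemma complex_measure_discrete:
  assumes \<mu>: "complex_measure \<mu>" and S: "locally_finite (measure_support \<mu>)"
  shows "discrete_on (measure_support \<mu>) (\<lambda>x. \<mu> {x}) \<mu>"
  unfolding discrete_on_def
proof (intro allI impI, elim conjE)
  fix E :: "'a set" assume E: "E \<in> sets borel" "bounded E"
  let ?S = "measure_support \<mu>"
  have fin: "finite (E \<inter> ?S)" by (rule locally_finite_Int_bounded[OF S E(2)])
  have fsum: "\<mu> F = (\<Sum>x\<in>F. \<mu> {x})" if "finite F" for F
    using that
  proof induction
    case (insert x F)
    have "\<mu> ({x} \<union> F) = \<mu> {x} + \<mu> F"
      using insert by (intro complex_measure_Un[OF \<mu>]) (auto intro: finite_imp_closed borel_closed finite_imp_bounded)
    then show ?case using insert by simp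
  qed (simp add: complex_measure_empty[OF \<mu>])
  have "\<mu> E = \<mu> (E \<inter> ?S \<union> (E - ?S))" by (rule arg_cong[of _ _ \<mu>]) auto
  also have "\<dots> = \<mu> (E \<inter> ?S) + \<mu> (E - ?S)"
    using E measure_support_closed[of \<mu>] bounded_subset[OF E(2)]
    by (intro complex_measure_Un[OF \<mu>]) (auto)
  also have "\<mu> (E - ?S) = 0"
    using E measure_support_closed[of \<mu>] bounded_subset[OF E(2)]
    by (intro complex_measure_null_off_support[OF \<mu>]) auto
  finally show "\<mu> E = (\<Sum>x\<in>E \<inter> ?S. \<mu> {x})" using fsum[OF fin] by simp
qed

text \<open>Only finitely many atoms lie in the bounded union, so additivity can be checked atom by
  atom; for one atom the series has a single term that can be nonzero.\<close>

lemma discrete_on_complex_measure: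
  assumes S: "locally_finite S" and m: "discrete_on S w m"
  shows "complex_measure m"
  unfolding complex_measure_def
proof (intro allI impI, elim conjE)
  fix A :: "nat \<Rightarrow> 'a set"
  assume A: "range A \<subseteq> sets borel" "disjoint_family A" "bounded (\<Union>i. A i)"
  let ?F = "(\<Union>i. A i) \<inter> S"
  have fin: "finite ?F" by (rule locally_finite_Int_bounded[OF S A(3)])
  have b: "bounded (A i)" for i using bounded_subset[OF A(3)] by blast
  have mA: "m (A i) = (\<Sum>x\<in>?F. if x \<in> A i then w x else 0)" for i
  proof -
    have "m (A i) = (\<Sum>x\<in>A i \<inter> S. w x)" using A b by (intro discrete_onD[OF m]) auto
    also have "A i \<inter> S = {x \<in> ?F. x \<in> A i}" by auto
    finally show ?thesis by (simp only: sum.inter_filter[OF fin])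
  qed
  have "(\<lambda>i. if x \<in> A i then w x else 0) sums w x" if x: "x \<in> ?F" for x
  proof -
    obtain j where j: "x \<in> A j" using x by auto
    then have "x \<in> A i \<longleftrightarrow> i = j" for i
      using A(2) unfolding disjoint_family_on_def by auto
    then have "(\<lambda>i. if x \<in> A i then w x else 0) = (\<lambda>i. if i = j then w x else 0)" by auto
    then show ?thesis using sums_single[of j "\<lambda>_. w x"] by simp
  qed
  then have "(\<lambda>i. m (A i)) sums (\<Sum>x\<in>?F. w x)"
    unfolding mA by (intro sums_sum) auto
  also have "(\<Sum>x\<in>?F. w x) = m (\<Union>i. A i)"
    using A by (subst discrete_onD[OF m]) auto
  finally show "(\<lambda>i. m (A i)) sums m (\<Union>i. A i)" .
qed

text \<open>\<open>ennreal\<close> sends negative weights to 0, so the right-hand side is the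
  measure of the positive atoms. On bounded sets the supremum is attained by the set of these atoms;
  an arbitrary Borel set is exhausted by its intersections with balls.\<close>

lemma upper_variation_discrete:
  fixes w :: "'a::euclidean_space \<Rightarrow> real"
  assumes S: "locally_finite S" and m: "discrete_on S w m"
  shows "upper_variation m = distr (point_measure S (\<lambda>x. ennreal (w x))) borel (\<lambda>x. x)"
proof -
  let ?P = "point_measure S (\<lambda>x. ennreal (w x))"
  let ?D = "distr ?P borel (\<lambda>x. x)"
  have meas: "(\<lambda>x. x) \<in> measurable ?P borel" by simp
  have D: "emeasure ?D E = (\<integral>\<^sup>+x. ennreal (w x) * indicator E x \<partial>count_space S)" if "E \<in> sets borel" for E
  proof -
    have "emeasure ?D E = emeasure ?P (E \<inter> S)"
      using that by (subst emeasure_distr[OF meas]) (auto simp: space_point_measure)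
    also have "\<dots> = (\<integral>\<^sup>+x. ennreal (w x) * indicator (E \<inter> S) x \<partial>count_space S)"
      unfolding point_measure_def by (subst emeasure_density) auto
    also have "\<dots> = (\<integral>\<^sup>+x. ennreal (w x) * indicator E x \<partial>count_space S)"
      by (intro nn_integral_cong) (auto simp: indicator_def)
    finally show ?thesis .
  qed
  have Dfin: "emeasure ?D E = (\<Sum>x\<in>E \<inter> S. ennreal (w x))" if "E \<in> sets borel" "bounded E" for E
    unfolding D[OF that(1)]
    using locally_finite_Int_bounded[OF S that(2)]
    by (subst nn_integral_count_space'[of "E \<inter> S"]) auto
  have eq: "(SUP B \<in> {B \<in> sets borel. bounded B \<and> B \<subseteq> E}. ennreal (m B)) = emeasure ?D E"
    if E: "E \<in> sets borel" for E
  proof (rule antisym)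
    show "(SUP B \<in> {B \<in> sets borel. bounded B \<and> B \<subseteq> E}. ennreal (m B)) \<le> emeasure ?D E"
    proof (rule SUP_least)
      fix B assume B: "B \<in> {B \<in> sets borel. bounded B \<and> B \<subseteq> E}"
      have "ennreal (m B) = ennreal (\<Sum>x\<in>B \<inter> S. w x)" using B by (simp add: discrete_onD[OF m])
      also have "\<dots> \<le> ennreal (\<Sum>x\<in>B \<inter> S. max 0 (w x))" by (intro ennreal_leI sum_mono) auto
      also have "\<dots> = (\<Sum>x\<in>B \<inter> S. ennreal (w x))" by (simp add: sum_ennreal[symmetric] ennreal_max_0 del: sum_ennreal)
      also have "\<dots> = emeasure ?D B" using B by (simp add: Dfin)
      also have "\<dots> \<le> emeasure ?D E" using B E by (intro emeasure_mono) auto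
      finally show "ennreal (m B) \<le> emeasure ?D E" .
    qed
    have bd: "emeasure ?D (E \<inter> ball 0 (real n)) \<le> (SUP B \<in> {B \<in> sets borel. bounded B \<and> B \<subseteq> E}. ennreal (m B))" for n
    proof -
      let ?E = "E \<inter> ball 0 (real n)"
      have E': "?E \<in> sets borel" "bounded ?E" using E by (auto intro: bounded_subset[OF bounded_ball])
      \<comment> \<open>The competitor that attains the supremum on a bounded set: it collects the
        atoms of positive weight and avoids all others.\<close>
      let ?B = "{x \<in> ?E \<inter> S. w x > 0}"
      have fin: "finite (?E \<inter> S)" by (rule locally_finite_Int_bounded[OF S E'(2)])
      then have finB: "finite ?B" by (rule rev_finite_subset) auto
      have "emeasure ?D ?E = (\<Sum>x\<in>?E \<inter> S. ennreal (w x))" by (rule Dfin[OF E'])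
      also have "\<dots> = (\<Sum>x\<in>?B. ennreal (w x))"
        using fin by (intro sum.mono_neutral_right) (auto simp: not_less[symmetric] intro: ccontr ennreal_neg)
      also have "\<dots> = ennreal (\<Sum>x\<in>?B. w x)" by (intro sum_ennreal) auto
      also have "(\<Sum>x\<in>?B. w x) = m ?B"
        using finB by (subst discrete_onD[OF m]) (auto intro!: sum.cong borel_closed finite_imp_closed finite_imp_bounded)
      also have "ennreal (m ?B) \<le> (SUP B \<in> {B \<in> sets borel. bounded B \<and> B \<subseteq> E}. ennreal (m B))"
        using finB by (intro SUP_upper) (auto intro!: borel_closed finite_imp_closed finite_imp_bounded)
      finally show ?thesis .
    qed
    have "emeasure ?D E = emeasure ?D (\<Union>n. E \<inter> ball 0 (real n))"
      by (rule arg_cong[of _ _ "emeasure ?D"]) (auto simp: reals_Archimedean2)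
    also have "\<dots> = (SUP n. emeasure ?D (E \<inter> ball 0 (real n)))"
      using E by (intro SUP_emeasure_incseq[symmetric]) (auto simp: incseq_def)
    also have "\<dots> \<le> (SUP B \<in> {B \<in> sets borel. bounded B \<and> B \<subseteq> E}. ennreal (m B))"
      using bd by (rule SUP_least)
    finally show "emeasure ?D E \<le> (SUP B \<in> {B \<in> sets borel. bounded B \<and> B \<subseteq> E}. ennreal (m B))" .
  qed
  \<comment> \<open>\<open>measure_of\<close> falls back to the zero measure when its set function
    is not a measure; agreement with \<open>emeasure ?D\<close> on the Borel sets excludes
    this.\<close>
  have "upper_variation m = measure_of UNIV (sets borel) (emeasure ?D)"
    unfolding upper_variation_def
    by (rule measure_of_eq) (use eq sets.sigma_sets_eq[of "borel :: 'a measure"] in auto)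
  also have "\<dots> = ?D" using measure_of_of_measure[of ?D] by simp
  finally show ?thesis .
qed

lemma integral_upper_variation_discrete:
  fixes w :: "'a::euclidean_space \<Rightarrow> real" and \<phi> :: "'a \<Rightarrow> complex"
  assumes S: "locally_finite S" and m: "discrete_on S w m"
    and \<phi>: "\<phi> \<in> borel_measurable borel" and F: "finite F" "F \<subseteq> S" "\<And>x. x \<in> S \<Longrightarrow> \<phi> x \<noteq> 0 \<Longrightarrow> x \<in> F"
  shows "(LINT x|upper_variation m. \<phi> x) = (\<Sum>x\<in>F. of_real (max 0 (w x)) * \<phi> x)"
proof -
  \<comment> \<open>Writing \<open>max 0 (w x)\<close> for the truncation performed by
    \<open>ennreal\<close> gives the nonnegative real density that \<open>integral_density\<close>
    asks for.\<close>
  have "(LINT x|upper_variation m. \<phi> x) = (LINT x|point_measure S (\<lambda>x. ennreal (max 0 (w x))). \<phi> x)"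
    unfolding upper_variation_discrete[OF S m] 
    by (subst integral_distr) (auto simp: \<phi> max_def ennreal_neg if_distrib cong: if_cong intro!: arg_cong2[of _ _ _ _ "integral\<^sup>L"] arg_cong[of _ _ "point_measure S"])
  also have "\<dots> = (LINT x|count_space S. max 0 (w x) *\<^sub>R \<phi> x)"
    unfolding point_measure_def by (intro integral_density) auto
  also have "\<dots> = (\<Sum>x | x \<in> S \<and> max 0 (w x) *\<^sub>R \<phi> x \<noteq> 0. max 0 (w x) *\<^sub>R \<phi> x)"
    using F by (intro lebesgue_integral_count_space_finite_support) (auto intro: finite_subset[of _ F])
  also have "\<dots> = (\<Sum>x\<in>F. max 0 (w x) *\<^sub>R \<phi> x)"
    using F by (intro sum.mono_neutral_left) auto
  finally show ?thesis by (simp add: scaleR_conv_of_real)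
qed

lemma complex_integral_discrete:
  fixes w :: "'a::euclidean_space \<Rightarrow> complex" and \<phi> :: "'a \<Rightarrow> complex"
  assumes S: "locally_finite S" and m: "discrete_on S w m"
    and \<phi>: "\<phi> \<in> borel_measurable borel" and F: "finite F" "F \<subseteq> S" "\<And>x. x \<in> S \<Longrightarrow> \<phi> x \<noteq> 0 \<Longrightarrow> x \<in> F"
  shows "complex_integral m \<phi> = (\<Sum>x\<in>F. w x * \<phi> x)"
proof -
  have 1: "discrete_on S (\<lambda>x. Re (w x)) (\<lambda>E. Re (m E))" "discrete_on S (\<lambda>x. - Re (w x)) (\<lambda>E. - Re (m E))"
    "discrete_on S (\<lambda>x. Im (w x)) (\<lambda>E. Im (m E))" "discrete_on S (\<lambda>x. - Im (w x)) (\<lambda>E. - Im (m E))"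
    using m by (auto simp: discrete_on_def sum_negf)
  \<comment> \<open>This identity recombines the four positive parts of the Jordan decompositions
    into the complex weight.\<close>
  have pm: "max 0 a - max 0 (- a) = a" for a :: real by simp
  have w: "w x = (of_real (max 0 (Re (w x))) - of_real (max 0 (- Re (w x))))
      + \<i> * (of_real (max 0 (Im (w x))) - of_real (max 0 (- Im (w x))))" for x
    unfolding of_real_diff[symmetric] pm by (rule complex_eq)
  have I: "(LINT x|upper_variation v. \<phi> x) = (\<Sum>x\<in>F. of_real (max 0 (u x)) * \<phi> x)"
    if "discrete_on S u v" for u v
    by (rule integral_upper_variation_discrete[OF S that \<phi> F(1,2)]) (rule F(3))
  note I = I[OF 1(1)] I[OF 1(2)] I[OF 1(3)] I[OF 1(4)]
  have "complex_integral m \<phi> = (\<Sum>x\<in>F. ((of_real (max 0 (Re (w x))) - of_real (max 0 (- Re (w x))))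
      + \<i> * (of_real (max 0 (Im (w x))) - of_real (max 0 (- Im (w x))))) * \<phi> x)"
    unfolding complex_integral_def I
    by (simp add: sum_subtractf sum.distrib sum_distrib_left algebra_simps)
  then show ?thesis by (simp only: w[symmetric])
qed

text \<open>Splitting off atoms can only increase the sum over a partition, so the supremum is
  reached when every atom of \<open>E\<close> is a block of its own.\<close>

lemma variation_discrete:
  assumes S: "locally_finite S" "closed S" and m: "discrete_on S w m"
  shows "discrete_on S (\<lambda>x. complex_of_real (norm (w x))) (variation m)"
  unfolding discrete_on_def
proof (intro allI impI, elim conjE)
  fix E :: "'a set" assume E: "E \<in> sets borel" "bounded E"
  have fin: "finite (E \<inter> S)" by (rule locally_finite_Int_bounded[OF S(1) E(2)])
  define \<P> where "\<P> = {P. finite P \<and> disjoint P \<and> P \<subseteq> sets borel \<and> \<Union>P = E}"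
  have up: "(\<Sum>B\<in>P. norm (m B)) \<le> (\<Sum>x\<in>E \<inter> S. norm (w x))" if P: "P \<in> \<P>" for P
  proof -
    have B: "bounded B" "B \<in> sets borel" "B \<subseteq> E" if "B \<in> P" for B
      using that P bounded_subset[OF E(2)] unfolding \<P>_def by auto
    have disj: "\<And>A B. A \<in> P \<Longrightarrow> B \<in> P \<Longrightarrow> A \<noteq> B \<Longrightarrow> A \<inter> B = {}"
      using P unfolding \<P>_def by (auto dest: disjointD)
    have "(\<Sum>B\<in>P. norm (m B)) \<le> (\<Sum>B\<in>P. \<Sum>x\<in>B \<inter> S. norm (w x))"
      using B by (intro sum_mono) (simp add: discrete_onD[OF m] norm_sum)
    also have "\<dots> = (\<Sum>x\<in>(\<Union>B\<in>P. B \<inter> S). norm (w x))"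
    proof (intro sum.UNION_disjoint[symmetric] ballI impI)
      show "finite P" using P unfolding \<P>_def by simp
      show "finite (B \<inter> S)" if "B \<in> P" for B by (rule locally_finite_Int_bounded[OF S(1) B(1)[OF that]])
      show "(A \<inter> S) \<inter> (B \<inter> S) = {}" if "A \<in> P" "B \<in> P" "A \<noteq> B" for A B
        using disj[OF that] by blast
    qed
    also have "(\<Union>B\<in>P. B \<inter> S) = E \<inter> S" using P unfolding \<P>_def by auto
    finally show ?thesis .
  qed
  \<comment> \<open>The optimal partition: singletons of atoms and one remaining block. It is finite
    because \<open>E\<close> is bounded, and \<open>E - S\<close> is Borel because \<open>S\<close>
    is closed.\<close>
  let ?P = "(\<lambda>x. {x}) ` (E \<inter> S) \<union> {E - S}"
  have P: "?P \<in> \<P>"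
    using fin E S(2) unfolding \<P>_def by (auto simp: disjoint_def intro!: borel_closed)
  have "(\<Sum>x\<in>E \<inter> S. norm (w x)) = (\<Sum>x\<in>E \<inter> S. norm (m {x}))"
    by (intro sum.cong) (auto simp: discrete_onD[OF m])
  also have "\<dots> = (\<Sum>B\<in>(\<lambda>x. {x}) ` (E \<inter> S). norm (m B))"
    by (subst sum.reindex) auto
  also have "\<dots> \<le> (\<Sum>B\<in>?P. norm (m B))"
    using fin by (intro sum_mono2) auto
  finally have low: "(\<Sum>x\<in>E \<inter> S. norm (w x)) \<le> (\<Sum>B\<in>?P. norm (m B))" .
  have "(SUP P\<in>\<P>. \<Sum>B\<in>P. norm (m B)) = (\<Sum>x\<in>E \<inter> S. norm (w x))"
  proof (rule antisym)
    have "\<P> \<noteq> {}" using P by blast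
    then show "(SUP P\<in>\<P>. \<Sum>B\<in>P. norm (m B)) \<le> (\<Sum>x\<in>E \<inter> S. norm (w x))"
      by (rule cSUP_least) (rule up)
    have "bdd_above ((\<lambda>P. \<Sum>B\<in>P. norm (m B)) ` \<P>)"
      by (rule bdd_aboveI2[of _ _ "\<Sum>x\<in>E \<inter> S. norm (w x)"]) (rule up)
    then show "(\<Sum>x\<in>E \<inter> S. norm (w x)) \<le> (SUP P\<in>\<P>. \<Sum>B\<in>P. norm (m B))"
      by (rule cSUP_upper2) (rule P low)+
  qed
  then show "variation m E = (\<Sum>x\<in>E \<inter> S. complex_of_real (norm (w x)))"
    unfolding variation_def \<P>_def by simp
qed

lemma measure_support_variation_subset:
  assumes \<mu>: "complex_measure \<mu>" and S: "locally_finite (measure_support \<mu>)"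
  shows "measure_support (variation \<mu>) \<subseteq> measure_support \<mu>"
proof -
  have v: "discrete_on (measure_support \<mu>) (\<lambda>x. complex_of_real (norm (\<mu> {x}))) (variation \<mu>)"
    by (intro variation_discrete S measure_support_closed complex_measure_discrete \<mu>)
  have "open (- measure_support \<mu>)" using measure_support_closed[of \<mu>] by auto
  moreover have "variation \<mu> E = 0" if "E \<in> sets borel" "bounded E" "E \<subseteq> - measure_support \<mu>" for E
  proof -
    have "E \<inter> measure_support \<mu> = {}" using that by auto
    then show ?thesis using discrete_onD[OF v that(1,2)] by simp
  qed
  ultimately show ?thesis unfolding measure_support_def[of "variation \<mu>"] by blast
qed

subsection \<open>Families of bump functions\<close>

text \<open>\<open>flat 0\<close> is the classical smooth function \<open>exp (- 1 / t)\<close>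
  extended by 0. Differentiation produces powers of \<open>1 / t\<close>, and including them makes
  the family closed under derivatives up to linear combinations.\<close>

definition flat :: "nat \<Rightarrow> real \<Rightarrow> real" where
  "flat k t = (if t \<le> 0 then 0 else exp (- inverse t) * inverse t ^ k)"

lemma flat_nonneg: "0 \<le> flat k t"
  by (simp add: flat_def)

text \<open>For \<open>u = 1 / t > 0\<close> the number \<open>u ^ k / fact k\<close> is a single
  term of the exponential series of \<open>u\<close>, hence at most \<open>exp u\<close>. The bound
  does not depend on \<open>t\<close>.\<close>

lemma flat_le_fact: "flat k t \<le> fact k"
proof (cases "t \<le> 0")
  case False
  define u where "u = inverse t"
  have u: "u > 0" using False by (simp add: u_def)
  have "u ^ k / fact k \<le> (\<Sum>n. u ^ n / fact n)"
    using u sum_le_suminf[of "\<lambda>n. u ^ n / fact n" "{k}"] summable_exp[of u]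
    by (simp add: field_simps)
  then have "u ^ k / fact k \<le> exp u"
    by (simp add: exp_def scaleR_conv_of_real field_simps)
  then have "u ^ k \<le> exp u * fact k" by (simp add: field_simps)
  then have "exp (- u) * u ^ k \<le> exp (- u) * (exp u * fact k)" by (intro mult_left_mono) auto
  also have "\<dots> = fact k" by (simp add: exp_minus)
  finally show ?thesis using False by (simp add: flat_def u_def)
qed (simp add: flat_def)

lemma flat_has_derivative:
  "(flat k has_real_derivative (flat (k + 2) t - real k * flat (k + 1) t)) (at t)"
proof (cases t "0 :: real" rule: linorder_cases)
  case less
  have "((\<lambda>t. 0) has_real_derivative 0) (at t)" by simp
  then have "(flat k has_real_derivative 0) (at t)"
    by (rule has_field_derivative_transform_within_open[where S = "{..<0}"]) (use less in \<open>auto simp: flat_def\<close>)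
  then show ?thesis using less by (simp add: flat_def)
next
  case equal
  have "((\<lambda>h. flat k h / h) \<longlongrightarrow> 0) (at 0)"
  proof (rule Lim_null_comparison)
    show "\<forall>\<^sub>F h in at 0. norm (flat k h / h) \<le> fact (k + 2) * \<bar>h\<bar>"
    proof (rule always_eventually, rule allI)
      fix h :: real
      show "norm (flat k h / h) \<le> fact (k + 2) * \<bar>h\<bar>"
      proof (cases "h \<le> 0")
        case False
        \<comment> \<open>Passing to \<open>k + 2\<close>, one more than the division by
          \<open>h\<close> accounts for, frees a factor \<open>h\<close>; as
          \<open>flat (k + 2)\<close> is bounded, the difference quotient tends to 0.\<close>
        then have "flat k h / h = flat (k + 2) h * h"
          by (simp add: flat_def field_simps power2_eq_square)
        then show ?thesis using False flat_le_fact[of "k + 2" h] flat_nonneg[of "k + 2" h]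
          by (simp add: abs_mult mult_right_mono del: fact_Suc)
      qed (simp add: flat_def zero_le_mult_iff del: fact_Suc abs_of_nonpos)
    qed
    show "((\<lambda>h. fact (k + 2) * \<bar>h\<bar>) \<longlongrightarrow> (0::real)) (at 0)"
      by (intro tendsto_mult_right_zero tendsto_rabs_zero tendsto_ident_at)
  qed
  then show ?thesis using equal by (simp add: has_field_derivative_iff flat_def)
next
  case greater
  have "((\<lambda>t. exp (- inverse t) * inverse t ^ k) has_real_derivative
      (flat (k + 2) t - real k * flat (k + 1) t)) (at t)"
  proof -
    \<comment> \<open>At \<open>k = 0\<close> the truncated exponent \<open>k - 1\<close> is wrong,
      but the factor \<open>real k\<close> vanishes there.\<close>
    have "real k * inverse t ^ (k - 1) * (inverse t)^2 = real k * inverse t ^ (k + 1)"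
      by (cases k) (auto simp: power2_eq_square)
    then show ?thesis
      using greater
      by (auto intro!: derivative_eq_intros simp: flat_def algebra_simps power2_eq_square)
  qed
  then show ?thesis
    by (rule has_field_derivative_transform_within_open[where S = "{0<..}"]) (use greater in \<open>auto simp: flat_def\<close>)
qed

text \<open>Functions of \<open>y\<close> depending on a parameter \<open>x\<close>, built from cutoffs to the ball
  of radius \<open>\<epsilon> x\<close> about \<open>x\<close>; the point is closure under differentiation in \<open>y\<close>.\<close>

inductive_set cutoff_algebra :: "('a::euclidean_space \<Rightarrow> real) \<Rightarrow> ('a \<Rightarrow> 'a \<Rightarrow> complex) set"
  for \<epsilon> :: "'a \<Rightarrow> real" where
  coeff: "moderate (\<lambda>x. norm (a x)) \<Longrightarrow> (\<lambda>x y. a x) \<in> cutoff_algebra \<epsilon>"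
| coord: "(\<lambda>x y. of_real (y \<bullet> c)) \<in> cutoff_algebra \<epsilon>"
| cut: "(\<lambda>x y. of_real (flat k (1 - (y - x) \<bullet> (y - x) / (\<epsilon> x)\<^sup>2))) \<in> cutoff_algebra \<epsilon>"
| add: "\<Phi> \<in> cutoff_algebra \<epsilon> \<Longrightarrow> \<Psi> \<in> cutoff_algebra \<epsilon> \<Longrightarrow> (\<lambda>x y. \<Phi> x y + \<Psi> x y) \<in> cutoff_algebra \<epsilon>"
| mult: "\<Phi> \<in> cutoff_algebra \<epsilon> \<Longrightarrow> \<Psi> \<in> cutoff_algebra \<epsilon> \<Longrightarrow> (\<lambda>x y. \<Phi> x y * \<Psi> x y) \<in> cutoff_algebra \<epsilon>"

lemma cutoff_algebra_const: "(\<lambda>x y. c) \<in> cutoff_algebra \<epsilon>"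
  by (rule cutoff_algebra.coeff[of "\<lambda>x. c"]) (rule moderate_const)

text \<open>The derivative is spelled out as sums and products of generators of
  \<open>cutoff_algebra\<close>. In particular \<open>(y - x) \<bullet> v\<close> is split into a
  coordinate of \<open>y\<close> and a coefficient depending on \<open>x\<close> alone.\<close>

lemma cut_has_derivative:
  fixes x y :: "'a::euclidean_space"
  shows "((\<lambda>y. complex_of_real (flat k (1 - (y - x) \<bullet> (y - x) / e\<^sup>2))) has_derivative
    (\<lambda>v. (of_real (flat (k + 2) (1 - (y - x) \<bullet> (y - x) / e\<^sup>2))
          + (- of_nat k) * of_real (flat (k + 1) (1 - (y - x) \<bullet> (y - x) / e\<^sup>2)))
        * (of_real (- 2 / e\<^sup>2) * (of_real (y \<bullet> v) + of_real (- (x \<bullet> v)))))) (at y)"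
proof -
  let ?t = "1 - (y - x) \<bullet> (y - x) / e\<^sup>2"
  have "((\<lambda>y. 1 - (y - x) \<bullet> (y - x) / e\<^sup>2) has_derivative (\<lambda>v. - 2 / e\<^sup>2 * ((y - x) \<bullet> v))) (at y)"
    unfolding divide_inverse
    by (auto intro!: derivative_eq_intros simp: inner_commute algebra_simps)
  from has_derivative_compose[OF this, of "flat k" "\<lambda>s. (flat (k + 2) ?t - real k * flat (k + 1) ?t) * s"]
  have "((\<lambda>y. flat k (1 - (y - x) \<bullet> (y - x) / e\<^sup>2)) has_derivative
      (\<lambda>v. (flat (k + 2) ?t - real k * flat (k + 1) ?t) * (- 2 / e\<^sup>2 * ((y - x) \<bullet> v)))) (at y)"
    using flat_has_derivative[of k ?t] by (simp add: has_field_derivative_def)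
  from bounded_linear.has_derivative[OF bounded_linear_of_real this]
  show ?thesis
    by (rule has_derivative_eq_rhs) (auto simp: inner_diff_left)
qed

text \<open>Positivity gives a genuine ball, the bound 1 places every cutoff within unit distance of
  its centre, and moderate growth of \<open>1 / \<epsilon>\<close> keeps the derivatives
  polynomially bounded in the centre.\<close>

locale cutoff_radius =
  fixes \<epsilon> :: "'a::euclidean_space \<Rightarrow> real"
  assumes radius_pos: "\<epsilon> x > 0" and radius_le_1: "\<epsilon> x \<le> 1" and radius_moderate: "moderate (\<lambda>x. 1 / \<epsilon> x)"
begin

lemma cutoff_algebra_derivative:
  assumes "\<Phi> \<in> cutoff_algebra \<epsilon>"
  shows "\<exists>D. (\<forall>x y. (\<Phi> x has_derivative D x y) (at y)) \<and> (\<forall>v. (\<lambda>x y. D x y v) \<in> cutoff_algebra \<epsilon>)"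
  using assms
proof induction
  case (coeff a)
  then show ?case
    by (intro exI[of _ "\<lambda>x y v. 0"]) (auto intro: cutoff_algebra_const)
next
  case (coord c)
  show ?case
    by (intro exI[of _ "\<lambda>x y v. of_real (v \<bullet> c)"])
      (auto intro!: derivative_eq_intros cutoff_algebra_const)
next
  case (cut k)
  \<comment> \<open>Each derivative of a cutoff brings out
    \<open>- 2 / (\<epsilon> x)\<^sup>2\<close>; it is an admissible coefficient because
    \<open>1 / \<epsilon>\<close> is moderate.\<close>
  have 1: "moderate (\<lambda>x. norm (complex_of_real (- 2 / (\<epsilon> x)\<^sup>2)))"
  proof -
    have "moderate (\<lambda>x. 2 * (1 / \<epsilon> x)^2)"
      using radius_pos by (intro moderate_mult moderate_power radius_moderate moderate_const) (auto intro: less_imp_le)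
    then show ?thesis by (simp add: norm_divide power_divide norm_power)
  qed
  have 2: "moderate (\<lambda>x. norm (complex_of_real (- (x \<bullet> v))))" for v :: 'a
  proof (rule moderateI[of _ "norm v" 1])
    fix x :: 'a
    have "norm x * norm v \<le> (1 + norm x) * norm v" by (intro mult_right_mono) auto
    then show "norm (complex_of_real (- (x \<bullet> v))) \<le> norm v * (1 + norm x) ^ 1"
      using Cauchy_Schwarz_ineq2[of x v] by (simp add: mult.commute)
  qed
  show ?case
    by (intro exI conjI allI, rule cut_has_derivative)
      (intro cutoff_algebra.intros(2-) cutoff_algebra_const cutoff_algebra.coeff[OF 1] cutoff_algebra.coeff[OF 2])
next
  case (add \<Phi> \<Psi>)
  then obtain D E where "\<forall>x y. (\<Phi> x has_derivative D x y) (at y)" "\<forall>v. (\<lambda>x y. D x y v) \<in> cutoff_algebra \<epsilon>"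
    "\<forall>x y. (\<Psi> x has_derivative E x y) (at y)" "\<forall>v. (\<lambda>x y. E x y v) \<in> cutoff_algebra \<epsilon>" by blast
  then show ?case
    by (intro exI[of _ "\<lambda>x y v. D x y v + E x y v"])
      (auto intro!: has_derivative_add cutoff_algebra.add)
next
  case (mult \<Phi> \<Psi>)
  then obtain D E where "\<forall>x y. (\<Phi> x has_derivative D x y) (at y)" "\<forall>v. (\<lambda>x y. D x y v) \<in> cutoff_algebra \<epsilon>"
    "\<forall>x y. (\<Psi> x has_derivative E x y) (at y)" "\<forall>v. (\<lambda>x y. E x y v) \<in> cutoff_algebra \<epsilon>" by blast
  then show ?case
    using mult by (intro exI[of _ "\<lambda>x y v. \<Phi> x y * E x y v + D x y v * \<Psi> x y"])
      (auto intro!: has_derivative_mult cutoff_algebra.add cutoff_algebra.mult)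
qed

text \<open>Coordinates are unbounded in \<open>y\<close>, so a bound in terms of \<open>x\<close>
  alone needs \<open>y\<close> near \<open>x\<close>: there the norm of \<open>y\<close> is at most
  \<open>1 + norm x\<close>. Cutoffs are bounded uniformly by \<open>flat_le_fact\<close>.\<close>

lemma cutoff_algebra_bound:
  assumes "\<Phi> \<in> cutoff_algebra \<epsilon>"
  shows "\<exists>a. moderate a \<and> (\<forall>x. 0 \<le> a x) \<and> (\<forall>x y. norm (y - x) \<le> 1 \<longrightarrow> norm (\<Phi> x y) \<le> a x)"
  using assms
proof induction
  case (coeff a)
  then show ?case by (intro exI[of _ "\<lambda>x. norm (a x)"]) auto
next
  case (coord c)
  have "norm (complex_of_real (y \<bullet> c)) \<le> (1 + norm x) * norm c" if "norm (y - x) \<le> 1" for x y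
  proof -
    have "norm y \<le> 1 + norm x" using that norm_triangle_sub[of y x] by linarith
    then have "norm y * norm c \<le> (1 + norm x) * norm c" by (intro mult_right_mono) auto
    then show ?thesis using Cauchy_Schwarz_ineq2[of y c] by simp
  qed
  moreover have "moderate (\<lambda>x. (1 + norm x) * norm c)"
    by (intro moderate_mult moderate_add moderate_const moderate_norm) auto
  ultimately show ?case by (intro exI[of _ "\<lambda>x. (1 + norm x) * norm c"]) auto
next
  case (cut k)
  show ?case
    by (intro exI[of _ "\<lambda>x. fact k"]) (auto simp: flat_nonneg flat_le_fact moderate_const)
next
  case (add \<Phi> \<Psi>)
  then obtain a b where "moderate a" "\<forall>x. 0 \<le> a x" "\<forall>x y. norm (y - x) \<le> 1 \<longrightarrow> norm (\<Phi> x y) \<le> a x"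
    "moderate b" "\<forall>x. 0 \<le> b x" "\<forall>x y. norm (y - x) \<le> 1 \<longrightarrow> norm (\<Psi> x y) \<le> b x" by blast
  then show ?case
    by (intro exI[of _ "\<lambda>x. a x + b x"]) (auto intro!: moderate_add norm_triangle_le add_mono)
next
  case (mult \<Phi> \<Psi>)
  then obtain a b where "moderate a" "\<forall>x. 0 \<le> a x" "\<forall>x y. norm (y - x) \<le> 1 \<longrightarrow> norm (\<Phi> x y) \<le> a x"
    "moderate b" "\<forall>x. 0 \<le> b x" "\<forall>x y. norm (y - x) \<le> 1 \<longrightarrow> norm (\<Psi> x y) \<le> b x" by blast
  then show ?case
    by (intro exI[of _ "\<lambda>x. a x * b x"]) (auto intro!: moderate_mult mult_mono simp: norm_mult)
qed

text \<open>Constants and coordinates lie in the algebra as well, so vanishing far from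
  \<open>x\<close> must be demanded separately. The strict inequality describes an open set of
  \<open>y\<close>, on which the derivatives then vanish too; hence the class is stable under
  differentiation.\<close>

definition bump_families :: "('a \<Rightarrow> 'a \<Rightarrow> complex) set" where
  "bump_families = {\<Phi> \<in> cutoff_algebra \<epsilon>. \<forall>x y. norm (y - x) > 1 \<longrightarrow> \<Phi> x y = 0}"

lemma bump_derivative:
  assumes "\<Phi> \<in> bump_families"
  shows "\<Phi> x differentiable (at y)"
    and "(\<lambda>x y. frechet_derivative (\<Phi> x) (at y) v) \<in> bump_families"
proof -
  obtain D where D: "\<And>x y. (\<Phi> x has_derivative D x y) (at y)" "\<And>v. (\<lambda>x y. D x y v) \<in> cutoff_algebra \<epsilon>"
    using cutoff_algebra_derivative assms unfolding bump_families_def by blast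
  show "\<Phi> x differentiable (at y)" using D(1) by (rule differentiableI)
  have "D x y v = 0" if "norm (y - x) > 1" for x y
  proof -
    have "((\<lambda>y. 0) has_derivative D x y) (at y)"
    proof (rule has_derivative_transform_within_open[OF D(1)])
      show "open {y. norm (y - x) > 1}" by (intro open_Collect_less continuous_intros)
      show "y \<in> {y. norm (y - x) > 1}" using that by simp
    qed (use assms in \<open>auto simp: bump_families_def\<close>)
    then show ?thesis using has_derivative_unique[OF _ has_derivative_const[of 0 "at y"]] by metis
  qed
  then show "(\<lambda>x y. frechet_derivative (\<Phi> x) (at y) v) \<in> bump_families"
    unfolding bump_families_def using D by (simp add: frechet_derivative_at[OF D(1), symmetric])
qed

lemma bump_mult: "\<Phi> \<in> bump_families \<Longrightarrow> \<Psi> \<in> cutoff_algebra \<epsilon> \<Longrightarrow> (\<lambda>x y. \<Psi> x y * \<Phi> x y) \<in> bump_families"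
  unfolding bump_families_def by (auto intro: cutoff_algebra.mult)

lemma bump_partials: "\<Phi> \<in> bump_families \<Longrightarrow> (\<lambda>x. partials bs (\<Phi> x)) \<in> bump_families"
  by (induction bs) (auto dest: bump_derivative(2))

lemma bump_smooth: "\<Phi> \<in> bump_families \<Longrightarrow> smooth (\<Phi> x)"
  unfolding smooth_def using bump_derivative(1)[OF bump_partials] by blast

lemma bump_bound:
  assumes "\<Phi> \<in> bump_families"
  shows "\<exists>a. moderate a \<and> (\<forall>x. 0 \<le> a x) \<and> (\<forall>x y. norm (\<Phi> x y) \<le> a x)"
proof -
  obtain a where "moderate a" "\<forall>x. 0 \<le> a x" "\<forall>x y. norm (y - x) \<le> 1 \<longrightarrow> norm (\<Phi> x y) \<le> a x"
    using cutoff_algebra_bound assms unfolding bump_families_def by blast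
  moreover from this have "norm (\<Phi> x y) \<le> a x" for x y
    using assms unfolding bump_families_def by (cases "norm (y - x) \<le> 1") auto
  ultimately show ?thesis by blast
qed

lemma bump_zero_outside: "\<Phi> \<in> bump_families \<Longrightarrow> norm y > norm x + 1 \<Longrightarrow> \<Phi> x y = 0"
  unfolding bump_families_def using norm_triangle_sub[of y x] by force

end

text \<open>One bound, uniform in \<open>y\<close> and moderate in \<open>x\<close>, serves twice:
  for fixed \<open>x\<close> it makes the supremum finite, and as a function of \<open>x\<close> it
  majorizes the seminorm.\<close>

lemma moderate_seminorms:
  assumes "\<And>x. smooth (\<Phi> x)"
    and "\<And>k bs. bs \<in> lists Basis \<Longrightarrow>
      \<exists>a. moderate a \<and> (\<forall>x y. norm y ^ k * norm (partials bs (\<Phi> x) y) \<le> a x)"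
  shows "\<Phi> x \<in> schwartz"
    and "bs \<in> lists Basis \<Longrightarrow> moderate (\<lambda>x. schwartz_seminorm k bs (\<Phi> x))"
proof -
  define a where "a k bs = (SOME a. moderate a \<and> (\<forall>x y. norm y ^ k * norm (partials bs (\<Phi> x) y) \<le> a x))" for k bs
  have a: "moderate (a k bs)" "norm y ^ k * norm (partials bs (\<Phi> x) y) \<le> a k bs x"
    if "bs \<in> lists Basis" for k bs x y
    using someI_ex[OF assms(2)[OF that], of k] unfolding a_def by blast+
  show "\<Phi> x \<in> schwartz" by (rule schwartzI[OF assms(1)]) (rule a(2))
  show "moderate (\<lambda>x. schwartz_seminorm k bs (\<Phi> x))" if "bs \<in> lists Basis"
    by (rule moderate_mono[OF a(1)[OF that, of k]])
      (auto simp: schwartz_seminorm_def intro!: cSUP_least a(2)[OF that])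
qed

lemma (in cutoff_radius) bump_schwartz:
  assumes "\<Phi> \<in> bump_families"
  shows "\<Phi> x \<in> schwartz"
    and "bs \<in> lists Basis \<Longrightarrow> moderate (\<lambda>x. schwartz_seminorm k bs (\<Phi> x))"
proof -
  have *: "\<exists>a. moderate a \<and> (\<forall>x y. norm y ^ k * norm (partials bs (\<Phi> x) y) \<le> a x)" for k bs
  proof -
    obtain a where a: "moderate a" "\<forall>x. 0 \<le> a x" "\<forall>x y. norm (partials bs (\<Phi> x) y) \<le> a x"
      using bump_bound[OF bump_partials[OF assms]] by blast
    \<comment> \<open>On the region where the family can be nonzero, \<open>norm y\<close> is at
      most \<open>norm x + 1\<close>, so the weight in \<open>y\<close> is absorbed into a
      polynomial in \<open>norm x\<close>.\<close>
    have "norm y ^ k * norm (partials bs (\<Phi> x) y) \<le> (norm x + 1) ^ k * a x" for x y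
    proof (cases "norm y > norm x + 1")
      case True
      then show ?thesis using bump_zero_outside[OF bump_partials[OF assms] True, of bs] a(2) by simp
    next
      case False
      then show ?thesis using a by (intro mult_mono power_mono) auto
    qed
    moreover have "moderate (\<lambda>x. (norm x + 1) ^ k * a x)"
      using a by (intro moderate_mult moderate_power moderate_add moderate_norm moderate_const) auto
    ultimately show ?thesis by blast
  qed
  show "\<Phi> x \<in> schwartz" by (rule moderate_seminorms(1)[of \<Phi>, OF bump_smooth[OF assms] *])
  show "moderate (\<lambda>x. schwartz_seminorm k bs (\<Phi> x))" if "bs \<in> lists Basis"
    by (rule moderate_seminorms(2)[of \<Phi>, OF bump_smooth[OF assms] * that])
qed

subsection \<open>Fourier transforms of bump functions\<close>

lemma integrable_compact_support:
  fixes g :: "'a::euclidean_space \<Rightarrow> complex"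
  assumes "g \<in> borel_measurable borel" "\<And>y. norm (g y) \<le> B" "\<And>y. norm y > R \<Longrightarrow> g y = 0"
  shows "integrable lborel g" 
    and "norm (integral\<^sup>L lborel g) \<le> B * measure lborel (cball (0::'a) R)"
proof -
  show g: "integrable lborel g"
    by (rule integrableI_bounded_set[of "cball 0 R" _ _ B])
      (use assms emeasure_lborel_cball_finite[of 0 R] in auto)
  have i: "integrable lborel (\<lambda>y::'a. B * indicator (cball 0 R) y)"
    using emeasure_lborel_cball_finite[of 0 R] by (intro integrable_mult_right integrable_real_indicator) auto
  have "norm (integral\<^sup>L lborel g) \<le> (LINT y|lborel. norm (g y))"
    by (rule integral_norm_bound)
  also have "\<dots> \<le> (LINT y|lborel. B * indicator (cball (0::'a) R) y)"
    using assms(2,3) by (intro integral_mono integrable_norm g i) (auto simp: indicator_def)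
  also have "\<dots> = B * measure lborel (cball (0::'a) R)" by simp
  finally show "norm (integral\<^sup>L lborel g) \<le> B * measure lborel (cball (0::'a) R)" .
qed

abbreviation wave :: "'a::euclidean_space \<Rightarrow> 'a \<Rightarrow> complex" where
  "wave \<xi> y \<equiv> exp (- 2 * of_real pi * \<i> * of_real (y \<bullet> \<xi>))"

lemma wave_add: "wave (\<xi> + \<eta>) y = wave \<xi> y * wave \<eta> y"
  by (simp add: inner_add_right exp_add[symmetric] algebra_simps)

lemma wave_quadratic: "norm (wave v y - 1 - (- 2 * of_real pi * \<i> * of_real (y \<bullet> v))) \<le> (2 * pi * (norm y * norm v))\<^sup>2"
proof -
  let ?z = "- 2 * of_real pi * \<i> * of_real (y \<bullet> v) :: complex"
  \<comment> \<open>The Taylor remainder carries the factor \<open>exp \<bar>Re z\<bar>\<close>,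
    which is 1 for imaginary \<open>z\<close>.\<close>
  have Taylor: "norm (exp z - 1 - z) \<le> norm z ^ 2" if "Re z = 0" for z
    using Taylor_exp[of z 1] that by (simp add: diff_diff_eq power2_eq_square)
  have "norm (exp ?z - 1 - ?z) \<le> norm ?z ^ 2" by (rule Taylor) simp
  also have "norm ?z = 2 * pi * \<bar>y \<bullet> v\<bar>" by (simp add: norm_mult)
  also have "\<dots> ^ 2 \<le> (2 * pi * (norm y * norm v))\<^sup>2"
    using Cauchy_Schwarz_ineq2[of y v] by (intro power_mono mult_left_mono) auto
  finally show ?thesis .
qed

lemma fourier_integrable:
  fixes g :: "'a::euclidean_space \<Rightarrow> complex"
  assumes "continuous_on UNIV g" "\<And>y. norm (g y) \<le> B" "\<And>y. norm y > R \<Longrightarrow> g y = 0"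
  shows "integrable lborel (\<lambda>y. g y * wave \<xi> y)"
    and "norm (fourier g \<xi>) \<le> B * measure lborel (cball (0::'a) R)"
proof -
  have "continuous_on UNIV (\<lambda>y. g y * wave \<xi> y)"
    by (intro continuous_intros assms(1))
  then have m: "(\<lambda>y. g y * wave \<xi> y) \<in> borel_measurable borel"
    by (rule borel_measurable_continuous_onI)
  show "integrable lborel (\<lambda>y. g y * wave \<xi> y)"
    by (rule integrable_compact_support(1)[OF m, of B R]) (use assms in \<open>auto simp: norm_mult\<close>)
  show "norm (fourier g \<xi>) \<le> B * measure lborel (cball (0::'a) R)"
    unfolding fourier_def
    by (rule integrable_compact_support(2)[OF m, of B R]) (use assms in \<open>auto simp: norm_mult\<close>)
qed

text \<open>The increment minus its linear part is the integral of \<open>g y * wave \<xi> y\<close>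
  against the second-order Taylor remainder of \<open>wave v\<close>. Since \<open>g\<close> is
  bounded and vanishes off a ball, this is at most a constant times the square of
  \<open>norm v\<close>.\<close>

lemma fourier_has_derivative:
  fixes g :: "'a::euclidean_space \<Rightarrow> complex"
  assumes g: "continuous_on UNIV g" "\<And>y. norm (g y) \<le> B" "\<And>y. norm y > R \<Longrightarrow> g y = 0"
  shows "(fourier g has_derivative (\<lambda>v. fourier (\<lambda>y. - 2 * of_real pi * \<i> * of_real (y \<bullet> v) * g y) \<xi>)) (at \<xi>)"
proof -
  define G where "G v y = - 2 * of_real pi * \<i> * of_real (y \<bullet> v) * g y" for v y
  have B: "0 \<le> B" using g(2)[of 0] norm_ge_zero order_trans by blast
  have Gc: "continuous_on UNIV (G v)" for v
    unfolding G_def by (intro continuous_intros g(1))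
  \<comment> \<open>\<open>R\<close> may be negative, in which case \<open>g\<close> vanishes
    identically; \<open>max R 0\<close> keeps the bound nonnegative and monotonicity arguments
    valid.\<close>
  have Gb: "norm (G v y) \<le> 2 * pi * (max R 0 * norm v) * B" for v y
  proof (cases "norm y > R")
    case False
    have "\<bar>y \<bullet> v\<bar> \<le> norm y * norm v" by (rule Cauchy_Schwarz_ineq2)
    also have "\<dots> \<le> max R 0 * norm v" using False by (intro mult_right_mono) auto
    finally have "2 * pi * \<bar>y \<bullet> v\<bar> * norm (g y) \<le> 2 * pi * (max R 0 * norm v) * B"
      using g(2) by (intro mult_mono) auto
    then show ?thesis by (simp add: G_def norm_mult)
  qed (use B g(3) in \<open>auto simp: G_def\<close>)
  have G0: "norm y > R \<Longrightarrow> G v y = 0" for v y using g(3) by (simp add: G_def)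
  have Gi: "integrable lborel (\<lambda>y. G v y * wave \<xi> y)" for v
    by (rule fourier_integrable(1)[OF Gc Gb G0])
  have gi: "integrable lborel (\<lambda>y. g y * wave \<eta> y)" for \<eta>
    by (rule fourier_integrable(1)[OF g])
  let ?K = "B * (2 * pi * max R 0)\<^sup>2 * measure lborel (cball (0::'a) R)"
  have est: "norm (fourier g (\<xi> + v) - fourier g \<xi> - fourier (G v) \<xi>) \<le> ?K * (norm v)\<^sup>2" for v
  proof -
    let ?r = "\<lambda>y. g y * wave \<xi> y * (wave v y - 1 - (- 2 * of_real pi * \<i> * of_real (y \<bullet> v)))"
    have factor: "p * (w * w') - p * w - z * p * w = p * w * (w' - 1 - z)" for p w w' z :: complex
      by (simp add: algebra_simps)
    have "fourier g (\<xi> + v) - fourier g \<xi> - fourier (G v) \<xi>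
        = (LINT y|lborel. g y * wave (\<xi> + v) y - g y * wave \<xi> y - G v y * wave \<xi> y)"
      unfolding fourier_def by (simp only: Bochner_Integration.integral_diff Bochner_Integration.integrable_diff gi Gi)
    also have "\<dots> = integral\<^sup>L lborel ?r"
      unfolding wave_add G_def
      by (intro Bochner_Integration.integral_cong refl factor)
    also have "norm \<dots> \<le> (B * (2 * pi * (max R 0 * norm v))\<^sup>2) * measure lborel (cball (0::'a) R)"
    proof (rule integrable_compact_support(2))
      have "continuous_on UNIV ?r" by (intro continuous_intros g(1))
      then show "?r \<in> borel_measurable borel" by (rule borel_measurable_continuous_onI)
      show "?r y = 0" if "norm y > R" for y using g(3)[OF that] by simp
      show "norm (?r y) \<le> B * (2 * pi * (max R 0 * norm v))\<^sup>2" for y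
      proof (cases "norm y > R")
        case True
        then show ?thesis using g(3)[OF True] B by simp
      next
        case False
        have "norm (?r y) = norm (g y) * norm (wave v y - 1 - (- 2 * of_real pi * \<i> * of_real (y \<bullet> v)))"
          by (simp add: norm_mult)
        also have "\<dots> \<le> B * (2 * pi * (norm y * norm v))\<^sup>2"
          using B by (intro mult_mono wave_quadratic g(2)) auto
        also have "\<dots> \<le> B * (2 * pi * (max R 0 * norm v))\<^sup>2"
          using B False by (intro mult_left_mono power_mono mult_right_mono) auto
        finally show ?thesis .
      qed
    qed
    finally show ?thesis by (simp add: power_mult_distrib mult_ac)
  qed
  have "bounded_linear (\<lambda>v. fourier (G v) \<xi>)"
  proof (rule linear_conv_bounded_linear[THEN iffD1], rule linearI)
    fix v w :: 'a and r :: real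
    have "fourier (G v) \<xi> + fourier (G w) \<xi> = (LINT y|lborel. G v y * wave \<xi> y + G w y * wave \<xi> y)"
      unfolding fourier_def by (simp only: Bochner_Integration.integral_add Gi)
    also have "\<dots> = fourier (G (v + w)) \<xi>"
      unfolding fourier_def 
      by (intro Bochner_Integration.integral_cong refl) (simp add: G_def inner_add_right algebra_simps)
    finally show "fourier (G (v + w)) \<xi> = fourier (G v) \<xi> + fourier (G w) \<xi>" by simp
    have "r *\<^sub>R fourier (G v) \<xi> = (LINT y|lborel. r *\<^sub>R (G v y * wave \<xi> y))"
      unfolding fourier_def by (simp only: Bochner_Integration.integral_scaleR_right)
    also have "\<dots> = fourier (G (r *\<^sub>R v)) \<xi>"
      unfolding fourier_def 
      by (intro Bochner_Integration.integral_cong refl) (simp add: G_def scaleR_conv_of_real algebra_simps)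
    finally show "fourier (G (r *\<^sub>R v)) \<xi> = r *\<^sub>R fourier (G v) \<xi>" by simp
  qed
  moreover have "norm ((fourier g \<eta> - fourier g \<xi>) - fourier (G (\<eta> - \<xi>)) \<xi>) / norm (\<eta> - \<xi>)
      \<le> ?K * norm (\<eta> - \<xi>)" if "\<eta> \<noteq> \<xi>" for \<eta>
    using est[of "\<eta> - \<xi>"] that by (simp add: divide_le_eq power2_eq_square mult.assoc)
  moreover have "((\<lambda>\<eta>. ?K * norm (\<eta> - \<xi>)) \<longlongrightarrow> 0) (at \<xi>)"
    by (intro tendsto_mult_right_zero tendsto_norm_zero LIM_zero tendsto_ident_at)
  ultimately have "(fourier g has_derivative (\<lambda>v. fourier (G v) \<xi>)) (at \<xi>)"
    by (intro has_derivativeI_sandwich[of 1 _ _ _ _ "\<lambda>\<eta>. ?K * norm (\<eta> - \<xi>)"]) auto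
  then show ?thesis unfolding G_def .
qed

text \<open>By translation invariance the integral of every difference quotient vanishes.\<close>

lemma integral_partial_derivative_zero:
  fixes g :: "'a::euclidean_space \<Rightarrow> complex"
  assumes D: "\<And>y. (g has_derivative D y) (at y)"
    and Dc: "continuous_on UNIV (\<lambda>y. D y b)" and DB: "\<And>y. norm (D y b) \<le> B"
    and gB: "\<And>y. norm (g y) \<le> C" and g0: "\<And>y. norm y > R \<Longrightarrow> g y = 0"
  shows "(LINT y|lborel. D y b) = 0"
proof -
  have gc: "continuous_on UNIV g"
    by (intro continuous_at_imp_continuous_on ballI has_derivative_continuous[OF D])
  have gm: "g \<in> borel_measurable borel" by (rule borel_measurable_continuous_onI[OF gc])
  have gi: "integrable lborel g" by (rule integrable_compact_support(1)[OF gm gB g0])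
  have B: "0 \<le> B" using DB[of 0] norm_ge_zero order_trans by blast
  define t where "t n = inverse (real (Suc n))" for n
  have t: "0 < t n" "t n \<le> 1" for n by (auto simp: t_def inverse_le_1_iff)
  define u where "u n y = (g (t n *\<^sub>R b + y) - g y) /\<^sub>R t n" for n y
  have shift: "integrable lborel (\<lambda>y. g (c + y))" "(LINT y|lborel. g (c + y)) = integral\<^sup>L lborel g" for c
  proof -
    have m: "(+) c \<in> measurable lborel (borel :: 'a measure)" by simp
    show "(LINT y|lborel. g (c + y)) = integral\<^sup>L lborel g"
      using integral_distr[OF m gm] by (simp add: lborel_distr_plus)
    show "integrable lborel (\<lambda>y. g (c + y))"
      using integrable_distr[OF m, of g] gi by (simp add: lborel_distr_plus)
  qed
  have u0: "integral\<^sup>L lborel (u n) = 0" for n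
  proof -
    have "integral\<^sup>L lborel (u n) = (LINT y|lborel. (g (t n *\<^sub>R b + y) - g y)) /\<^sub>R t n"
      unfolding u_def[abs_def] by (rule integral_scaleR_right)
    also have "(LINT y|lborel. (g (t n *\<^sub>R b + y) - g y)) = 0"
      by (subst Bochner_Integration.integral_diff) (auto intro: shift gi simp: shift(2))
    finally show ?thesis by simp
  qed
  have line: "((\<lambda>s. g (y + s *\<^sub>R b)) has_derivative (\<lambda>r. r *\<^sub>R D (y + s *\<^sub>R b) b)) (at s)" for y s
  proof -
    have "((\<lambda>s. g (y + s *\<^sub>R b)) has_derivative (\<lambda>r. D (y + s *\<^sub>R b) (r *\<^sub>R b))) (at s)"
      by (rule has_derivative_compose[OF _ D]) (auto intro!: derivative_eq_intros)
    then show ?thesis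
      by (simp add: linear_cmul[OF has_derivative_linear[OF D]])
  qed
  have lip: "norm (g (s *\<^sub>R b + y) - g y) \<le> B * s" if "s > 0" for s y
  proof -
    have "continuous_on {0..s} (\<lambda>s. g (y + s *\<^sub>R b))"
      by (intro continuous_on_compose2[OF gc] continuous_intros) auto
    from mvt_general[OF that this line]
    obtain r where "norm (g (y + s *\<^sub>R b) - g (y + 0 *\<^sub>R b)) \<le> norm ((s - 0) *\<^sub>R D (y + r *\<^sub>R b) b)"
      by blast
    also have "\<dots> \<le> s * B" using that DB by (simp add: mult_left_mono)
    finally show ?thesis by (simp add: add.commute mult.commute)
  qed
  \<comment> \<open>Steps \<open>t n \<le> 1\<close> move points by at most \<open>norm b\<close>,
    so all difference quotients vanish off one ball; on it the mean value estimate
    \<open>lip\<close> bounds them by \<open>B\<close>. This is the integrable majorant for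
    dominated convergence.\<close>
  have u_bound: "norm (u n y) \<le> B * indicator (cball 0 (R + norm b)) y" for n y
  proof (cases "norm y \<le> R + norm b")
    case True
    have "norm (u n y) = norm (g (t n *\<^sub>R b + y) - g y) / t n"
      using t(1)[of n] by (simp add: u_def divide_inverse mult.commute)
    then show ?thesis
      using True lip[OF t(1), of n y] t(1)[of n] by (simp add: divide_le_eq)
  next
    case False
    have "norm y \<le> norm (t n *\<^sub>R b + y) + norm (t n *\<^sub>R b)"
      using norm_triangle_ineq4[of "t n *\<^sub>R b + y" "t n *\<^sub>R b"] by simp
    moreover have "norm (t n *\<^sub>R b) \<le> norm b" using t[of n] by (simp add: mult_left_le_one_le)
    ultimately have "norm (t n *\<^sub>R b + y) > R" "norm y > R" using False norm_ge_zero[of b] by linarith+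
    then show ?thesis using g0 B by (simp add: u_def)
  qed
  have u_lim: "(\<lambda>n. u n y) \<longlonglongrightarrow> D y b" for y
  proof -
    have "((\<lambda>s. norm (g (y + s *\<^sub>R b) - g y - s *\<^sub>R D y b) / norm s) \<longlongrightarrow> 0) (at 0)"
      using line[of y 0] by (simp add: has_derivative_at)
    moreover have "filterlim t (at 0) sequentially"
      using t(1) LIMSEQ_inverse_real_of_nat unfolding filterlim_at t_def[abs_def]
      by (auto simp: less_imp_neq[symmetric])
    ultimately have "(\<lambda>n. norm (g (y + t n *\<^sub>R b) - g y - t n *\<^sub>R D y b) / norm (t n)) \<longlonglongrightarrow> 0"
      by (rule filterlim_compose)
    moreover have "norm (g (y + t n *\<^sub>R b) - g y - t n *\<^sub>R D y b) / norm (t n) = norm (u n y - D y b)" for n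
    proof -
      have "u n y - D y b = (g (y + t n *\<^sub>R b) - g y - t n *\<^sub>R D y b) /\<^sub>R t n"
        using t(1)[of n] by (simp add: u_def scaleR_right_diff_distrib add.commute)
      then show ?thesis by (simp add: divide_inverse mult.commute)
    qed
    ultimately show ?thesis
      by (simp add: LIM_zero_cancel tendsto_norm_zero_iff)
  qed
  have "(\<lambda>n. integral\<^sup>L lborel (u n)) \<longlonglongrightarrow> (LINT y|lborel. D y b)"
  proof (rule integral_dominated_convergence)
    show "(\<lambda>y. D y b) \<in> borel_measurable lborel"
      using borel_measurable_continuous_onI[OF Dc] by simp
    show "u n \<in> borel_measurable lborel" for n
      unfolding u_def[abs_def] using gm by measurable
    show "integrable lborel (\<lambda>y::'a. B * indicator (cball 0 (R + norm b)) y)"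
      using emeasure_lborel_cball_finite[of "0 :: 'a" "R + norm b"]
      by (intro integrable_mult_right integrable_real_indicator) auto
  qed (use u_bound u_lim in auto)
  then show ?thesis by (simp add: u0 LIMSEQ_const_iff)
qed

section \<open>Integration by parts and the decay of the transforms of bumps\<close>

lemma wave_has_derivative:
  "(wave \<xi> has_derivative (\<lambda>v. - 2 * of_real pi * \<i> * of_real (v \<bullet> \<xi>) * wave \<xi> y)) (at y)"
proof -
  have "((\<lambda>y. - 2 * of_real pi * \<i> * of_real (y \<bullet> \<xi>)) has_derivative (\<lambda>v. - 2 * of_real pi * \<i> * complex_of_real (v \<bullet> \<xi>))) (at y)"
    by (intro has_derivative_mult_right bounded_linear.has_derivative[OF bounded_linear_of_real]
        has_derivative_inner_left has_derivative_ident)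
  from has_derivative_compose[OF this, of exp "(*) (wave \<xi> y)"]
  show ?thesis
    using DERIV_exp[of "- 2 * of_real pi * \<i> * complex_of_real (y \<bullet> \<xi>)"]
    by (simp add: has_field_derivative_def mult.commute)
qed

context cutoff_radius
begin

lemma bump_continuous: "\<Phi> \<in> bump_families \<Longrightarrow> continuous_on UNIV (\<Phi> x)"
  by (rule smooth_continuous_on[OF bump_smooth])

text \<open>Integration by parts: the integral of the derivative of
  \<open>\<Phi> x y * wave \<xi> y\<close> in direction \<open>b\<close> is 0, and the product rule
  splits it into the two sides.\<close>

lemma bump_fourier_partial:
  assumes \<Phi>: "\<Phi> \<in> bump_families"
  shows "2 * of_real pi * \<i> * of_real (b \<bullet> \<xi>) * fourier (\<Phi> x) \<xi>
    = fourier (\<lambda>y. frechet_derivative (\<Phi> x) (at y) b) \<xi>"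
proof -
  let ?D = "\<lambda>y. frechet_derivative (\<Phi> x) (at y)"
  have D: "(\<Phi> x has_derivative ?D y) (at y)" for y
    using bump_derivative(1)[OF \<Phi>] frechet_derivative_works by blast
  have D': "(\<lambda>x y. frechet_derivative (\<Phi> x) (at y) b) \<in> bump_families" by (rule bump_derivative(2)[OF \<Phi>])
  obtain B where B: "\<And>y. norm (\<Phi> x y) \<le> B" using bump_bound[OF \<Phi>] by blast
  obtain B' where B': "\<And>y. norm (?D y b) \<le> B'" using bump_bound[OF D'] by blast
  let ?w = "\<lambda>v y. - 2 * of_real pi * \<i> * of_real (v \<bullet> \<xi>) * wave \<xi> y :: complex"
  have c: "continuous_on UNIV (\<lambda>y. ?D y b)" using bump_continuous[OF D'] .
  have i1: "integrable lborel (\<lambda>y. (- 2 * of_real pi * \<i> * of_real (b \<bullet> \<xi>)) * (\<Phi> x y * wave \<xi> y))"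
    by (intro integrable_mult_right fourier_integrable(1)[OF bump_continuous[OF \<Phi>] B bump_zero_outside[OF \<Phi>]])
  have i2: "integrable lborel (\<lambda>y. ?D y b * wave \<xi> y)"
    by (rule fourier_integrable(1)[OF c B' bump_zero_outside[OF D']])
  have "(LINT y|lborel. \<Phi> x y * ?w b y + ?D y b * wave \<xi> y) = 0"
  proof (rule integral_partial_derivative_zero[where D = "\<lambda>y v. \<Phi> x y * ?w v y + ?D y v * wave \<xi> y"])
    show "((\<lambda>y. \<Phi> x y * wave \<xi> y) has_derivative (\<lambda>v. \<Phi> x y * ?w v y + ?D y v * wave \<xi> y)) (at y)" for y
      by (rule has_derivative_mult[OF D wave_has_derivative])
    show "continuous_on UNIV (\<lambda>y. \<Phi> x y * ?w b y + ?D y b * wave \<xi> y)"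
      by (intro continuous_intros bump_continuous[OF \<Phi>] c)
    show "norm (\<Phi> x y * ?w b y + ?D y b * wave \<xi> y) \<le> B * (2 * pi * \<bar>b \<bullet> \<xi>\<bar>) + B'" for y
      using B[of y] B'[of y] by (intro norm_triangle_le add_mono) (auto simp: norm_mult intro!: mult_right_mono)
    show "norm (\<Phi> x y * wave \<xi> y) \<le> B" for y using B by (simp add: norm_mult)
    show "\<Phi> x y * wave \<xi> y = 0" if "norm y > norm x + 1" for y
      using bump_zero_outside[OF \<Phi> that] by simp
  qed
  also have "(LINT y|lborel. \<Phi> x y * ?w b y + ?D y b * wave \<xi> y)
      = (LINT y|lborel. (- 2 * of_real pi * \<i> * of_real (b \<bullet> \<xi>)) * (\<Phi> x y * wave \<xi> y) + ?D y b * wave \<xi> y)"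
    by (simp add: algebra_simps)
  also have "\<dots> = - 2 * of_real pi * \<i> * of_real (b \<bullet> \<xi>) * fourier (\<Phi> x) \<xi> + fourier (\<lambda>y. ?D y b) \<xi>"
    unfolding fourier_def Bochner_Integration.integral_add[OF i1 i2] integral_mult_right_zero ..
  finally show ?thesis by (simp add: algebra_simps)
qed

text \<open>Each factor \<open>norm \<xi>\<close> is traded for a partial derivative of the family.
  Derivatives stay in \<open>bump_families\<close>, which is why the induction runs over all
  families at once.\<close>

lemma bump_fourier_bound:
  assumes "\<Phi> \<in> bump_families"
  shows "\<exists>a. moderate a \<and> (\<forall>x \<xi>. norm \<xi> ^ k * norm (fourier (\<Phi> x) \<xi>) \<le> a x)"
  using assms
proof (induction k arbitrary: \<Phi>)
  case 0
  obtain a where a: "moderate a" "\<And>x. 0 \<le> a x" "\<And>x y. norm (\<Phi> x y) \<le> a x"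
    using bump_bound[OF 0] by blast
  let ?V = "\<lambda>x::'a. measure lborel (cball (0::'a) (norm x + 1))"
  \<comment> \<open>Without a weight the transform is bounded by the supremum times the volume of a
    ball of radius \<open>norm x + 1\<close>, and that volume is polynomial in
    \<open>norm x\<close>.\<close>
  have "norm (fourier (\<Phi> x) \<xi>) \<le> a x * ?V x" for x \<xi>
    by (rule fourier_integrable(2)[OF bump_continuous[OF 0] a(3) bump_zero_outside[OF 0]])
  moreover have "?V x = unit_ball_vol (real DIM('a)) * (norm x + 1) ^ DIM('a)" for x
    by (rule content_cball) simp
  moreover have "moderate (\<lambda>x::'a. a x * (unit_ball_vol (real DIM('a)) * (norm x + 1) ^ DIM('a)))"
    using a by (intro moderate_mult moderate_power moderate_add moderate_norm moderate_const) auto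
  ultimately show ?case
    by (intro exI[of _ "\<lambda>x. a x * (unit_ball_vol (real DIM('a)) * (norm x + 1) ^ DIM('a))"]) simp
next
  case (Suc k)
  have "\<forall>b. \<exists>a. moderate a \<and> (\<forall>x \<xi>. norm \<xi> ^ k * norm (fourier (\<lambda>y. frechet_derivative (\<Phi> x) (at y) b) \<xi>) \<le> a x)"
    by (rule allI) (rule Suc.IH[OF bump_derivative(2)[OF Suc.prems]])
  from choice[OF this] obtain a where a: "\<And>b. moderate (a b)"
    "\<And>b x \<xi>. norm \<xi> ^ k * norm (fourier (\<lambda>y. frechet_derivative (\<Phi> x) (at y) b) \<xi>) \<le> a b x" by blast
  have "norm \<xi> ^ Suc k * norm (fourier (\<Phi> x) \<xi>) \<le> (\<Sum>b\<in>Basis. a b x)" for x \<xi>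
  proof -
    have "norm \<xi> ^ Suc k * norm (fourier (\<Phi> x) \<xi>)
        \<le> (\<Sum>b\<in>Basis. \<bar>\<xi> \<bullet> b\<bar>) * (norm \<xi> ^ k * norm (fourier (\<Phi> x) \<xi>))"
      using norm_le_l1[of \<xi>] by (simp add: mult_right_mono mult.assoc)
    also have "\<dots> = (\<Sum>b\<in>Basis. norm \<xi> ^ k * (\<bar>b \<bullet> \<xi>\<bar> * norm (fourier (\<Phi> x) \<xi>)))"
      by (simp add: sum_distrib_left sum_distrib_right mult_ac inner_commute)
    also have "\<dots> \<le> (\<Sum>b\<in>Basis. a b x)"
    proof (rule sum_mono)
      fix b :: 'a
      \<comment> \<open>The factor \<open>2 * pi\<close> from integration by parts is at least 1, so
        inserting it only enlarges the right-hand side.\<close>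
      have "\<bar>b \<bullet> \<xi>\<bar> * norm (fourier (\<Phi> x) \<xi>) \<le> 2 * pi * (\<bar>b \<bullet> \<xi>\<bar> * norm (fourier (\<Phi> x) \<xi>))"
        using mult_right_mono[of 1 "2 * pi" "\<bar>b \<bullet> \<xi>\<bar> * norm (fourier (\<Phi> x) \<xi>)"] pi_ge_two by simp
      also have "\<dots> = norm (2 * of_real pi * \<i> * of_real (b \<bullet> \<xi>) * fourier (\<Phi> x) \<xi>)"
        by (simp add: norm_mult)
      also have "\<dots> = norm (fourier (\<lambda>y. frechet_derivative (\<Phi> x) (at y) b) \<xi>)"
        by (simp only: bump_fourier_partial[OF Suc.prems])
      finally show "norm \<xi> ^ k * (\<bar>b \<bullet> \<xi>\<bar> * norm (fourier (\<Phi> x) \<xi>)) \<le> a b x"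
        by (rule order_trans[OF mult_left_mono[OF _ zero_le_power[OF norm_ge_zero]] a(2)])
    qed
    finally show ?thesis .
  qed
  moreover have "moderate (\<lambda>x. \<Sum>b\<in>Basis. a b x)" by (intro moderate_sum a)
  ultimately show ?case by blast
qed

lemma bump_fourier_has_derivative:
  assumes \<Phi>: "\<Phi> \<in> bump_families"
  shows "(fourier (\<Phi> x) has_derivative
    (\<lambda>v. fourier (\<lambda>y. - 2 * of_real pi * \<i> * of_real (y \<bullet> v) * \<Phi> x y) \<xi>)) (at \<xi>)"
proof -
  obtain B where B: "\<And>y. norm (\<Phi> x y) \<le> B" using bump_bound[OF \<Phi>] by blast
  show ?thesis by (rule fourier_has_derivative[OF bump_continuous[OF \<Phi>] B bump_zero_outside[OF \<Phi>]])
qed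

text \<open>Differentiating a transform multiplies the family by a constant and a coordinate of
  \<open>y\<close>, both of which belong to \<open>cutoff_algebra\<close>; so the partials are again
  transforms of bump families, and the decay estimate applies to them unchanged.\<close>

lemma bump_fourier_partials:
  assumes "\<Phi> \<in> bump_families"
  shows "\<exists>\<Psi> \<in> bump_families. \<forall>x. partials bs (fourier (\<Phi> x)) = fourier (\<Psi> x)"
proof (induction bs)
  case Nil
  then show ?case using assms by auto
next
  case (Cons b bs)
  then obtain \<Psi> where \<Psi>: "\<Psi> \<in> bump_families" "\<And>x. partials bs (fourier (\<Phi> x)) = fourier (\<Psi> x)" by blast
  have 1: "(\<lambda>x y. - 2 * of_real pi * \<i> * of_real (y \<bullet> b) * \<Psi> x y) \<in> bump_families"
    by (rule bump_mult[OF \<Psi>(1)]) (intro cutoff_algebra.mult cutoff_algebra.coord cutoff_algebra_const)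
  have 2: "partials (b # bs) (fourier (\<Phi> x)) = fourier (\<lambda>y. - 2 * of_real pi * \<i> * of_real (y \<bullet> b) * \<Psi> x y)" for x
    using fun_cong[OF frechet_derivative_at[OF bump_fourier_has_derivative[OF \<Psi>(1)]], symmetric]
    by (auto simp: \<Psi>(2))
  show ?case 
    by (rule bexI[of _ "\<lambda>x y. - 2 * of_real pi * \<i> * of_real (y \<bullet> b) * \<Psi> x y", OF allI 1]) (rule 2)
qed

lemma bump_fourier_schwartz:
  assumes "\<Phi> \<in> bump_families"
  shows "fourier (\<Phi> x) \<in> schwartz"
    and "bs \<in> lists Basis \<Longrightarrow> moderate (\<lambda>x. schwartz_seminorm k bs (fourier (\<Phi> x)))"
proof -
  have s: "smooth (fourier (\<Phi> x))" for x
    unfolding smooth_def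
  proof (intro ballI allI)
    fix bs y
    obtain \<Psi> where \<Psi>: "\<Psi> \<in> bump_families" "\<And>x. partials bs (fourier (\<Phi> x)) = fourier (\<Psi> x)"
      using bump_fourier_partials[OF assms] by blast
    show "partials bs (fourier (\<Phi> x)) differentiable (at y)"
      unfolding \<Psi>(2) by (rule differentiableI[OF bump_fourier_has_derivative[OF \<Psi>(1)]])
  qed
  have *: "\<exists>a. moderate a \<and> (\<forall>x y. norm y ^ k * norm (partials bs (fourier (\<Phi> x)) y) \<le> a x)" for k bs
  proof -
    obtain \<Psi> where \<Psi>: "\<Psi> \<in> bump_families" "\<And>x. partials bs (fourier (\<Phi> x)) = fourier (\<Psi> x)"
      using bump_fourier_partials[OF assms] by blast
    show ?thesis unfolding \<Psi>(2) by (rule bump_fourier_bound[OF \<Psi>(1)])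
  qed
  show "fourier (\<Phi> x) \<in> schwartz" by (rule moderate_seminorms(1)[of "\<lambda>x. fourier (\<Phi> x)", OF s *])
  show "moderate (\<lambda>x. schwartz_seminorm k bs (fourier (\<Phi> x)))" if "bs \<in> lists Basis"
    by (rule moderate_seminorms(2)[of "\<lambda>x. fourier (\<Phi> x)", OF s * that])
qed

end

subsection \<open>Summation over p-discrete sets\<close>

lemma one_le_one_plus_norm_power: "1 \<le> (1 + norm x) ^ N"
  by (rule one_le_power) simp

text \<open>Replacing \<open>norm x\<close> by \<open>1 + norm x\<close> and \<open>h\<close> by an
  integer \<open>N \<ge> h\<close> only weakens the separation and removes the exceptional case
  \<open>x = 0\<close>. The bound \<open>c \<le> 1\<close> makes the right-hand scale usable as a
  \<open>cutoff_radius\<close>.\<close>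

lemma p_discrete_separation:
  fixes S :: "'a::euclidean_space set"
  assumes "p_discrete S"
  shows "\<exists>c N. 0 < c \<and> c \<le> 1 \<and> (\<forall>x\<in>S. \<forall>x'\<in>S. x \<noteq> x' \<longrightarrow> c / (1 + norm x) ^ N \<le> norm (x - x'))"
proof -
  obtain c h where c: "c > 0" and h: "h > 0" and
    sep: "\<And>x x'. x \<in> S \<Longrightarrow> x' \<in> S \<Longrightarrow> x \<noteq> x' \<Longrightarrow> norm (x - x') \<ge> c * (if x = 0 then 1 else min 1 (norm x powr (- h)))"
    using assms unfolding p_discrete_def by blast
  define N where "N = nat \<lceil>h\<rceil>"
  have N: "h \<le> real N" unfolding N_def by linarith
  have lower: "1 / (1 + norm x) ^ N \<le> (if x = 0 then 1 else min 1 (norm x powr (- h)))" for x :: 'a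
  proof (cases "x = 0")
    case False
    have "1 / (1 + norm x) ^ N = (1 + norm x) powr (- real N)"
      using norm_ge_zero[of x] by (simp add: powr_minus powr_realpow divide_inverse add_pos_nonneg)
    also have "\<dots> \<le> (1 + norm x) powr (- h)" using N by (intro powr_mono) auto
    also have "\<dots> \<le> norm x powr (- h)" using h False by (intro powr_mono2') auto
    finally have "1 / (1 + norm x) ^ N \<le> norm x powr (- h)" .
    moreover have "1 / (1 + norm x) ^ N \<le> 1"
      unfolding divide_le_eq_1 using one_le_one_plus_norm_power[of x N] by linarith
    ultimately show ?thesis using False by simp
  qed simp
  have "min c 1 / (1 + norm x) ^ N \<le> norm (x - x')" if "x \<in> S" "x' \<in> S" "x \<noteq> x'" for x x'
  proof -
    have "min c 1 / (1 + norm x) ^ N \<le> c * (1 / (1 + norm x) ^ N)"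
      by (simp add: divide_right_mono)
    also have "\<dots> \<le> c * (if x = 0 then 1 else min 1 (norm x powr (- h)))"
      using c lower[of x] by (intro mult_left_mono) auto
    finally show ?thesis using sep[OF that] by linarith
  qed
  then show ?thesis using c by (intro exI[of _ "min c 1"] exI[of _ N]) auto
qed

text \<open>Packing argument: inside the ball of radius \<open>R\<close> the points are at least
  \<open>2 * d\<close> apart, so the balls of radius \<open>d\<close> about them are disjoint; as
  \<open>d \<le> 1\<close> they fit into the ball of radius \<open>1 + R\<close>, and volumes are
  compared.\<close>

lemma p_discrete_card:
  fixes S :: "'a::euclidean_space set"
  assumes "p_discrete S"
  shows "\<exists>A M. 0 < A \<and> (\<forall>R\<ge>0. \<forall>F. finite F \<and> F \<subseteq> S \<inter> cball 0 R \<longrightarrow> real (card F) \<le> A * (1 + R) ^ M)"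
proof -
  obtain c N where c: "0 < c" "c \<le> 1" and
    sep: "\<And>x x'. x \<in> S \<Longrightarrow> x' \<in> S \<Longrightarrow> x \<noteq> x' \<Longrightarrow> c / (1 + norm x) ^ N \<le> norm (x - x')"
    using p_discrete_separation[OF assms] by blast
  let ?n = "DIM('a)"
  have "real (card F) \<le> (2 / c) ^ ?n * (1 + R) ^ ((N + 1) * ?n)"
    if R: "R \<ge> 0" and F: "finite F" "F \<subseteq> S \<inter> cball 0 R" for R F
  proof -
    define d where "d = c / (1 + R) ^ N / 2"
    have d: "d > 0" using c R by (simp add: d_def)
    have "c / (1 + R) ^ N \<le> 1"
      using c R by (simp add: divide_le_eq_1 order_trans[OF c(2)] one_le_power)
    then have d1: "d \<le> 1" by (simp add: d_def)
    have disj: "disjoint_family_on (\<lambda>x. ball x d) F"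
      unfolding disjoint_family_on_def
    proof (intro ballI impI)
      fix x y assume xy: "x \<in> F" "y \<in> F" "x \<noteq> y"
      have "norm x \<le> R" using xy F by auto
      have "2 * d \<le> c / (1 + norm x) ^ N"
        unfolding d_def using c R \<open>norm x \<le> R\<close>
        by (auto intro!: divide_left_mono power_mono mult_pos_pos simp: add_pos_nonneg)
      also have "\<dots> \<le> dist x y" using sep[of x y] xy F by (auto simp: dist_norm)
      finally show "ball x d \<inter> ball y d = {}" by (intro disjoint_ballI) simp
    qed
    have "real (card F) * (unit_ball_vol ?n * d ^ ?n) = (\<Sum>x\<in>F. measure lborel (ball x d))"
      using d by (simp add: content_ball)
    also have "\<dots> = measure lborel (\<Union>x\<in>F. ball x d)"
      using emeasure_lborel_ball_finite[where 'a = 'a]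
      by (intro measure_finite_Union[symmetric] F disj) (auto simp: less_top[symmetric])
    also have "\<dots> \<le> measure lborel (cball (0::'a) (1 + R))"
    proof (rule measure_mono_fmeasurable)
      show "(\<Union>x\<in>F. ball x d) \<subseteq> cball 0 (1 + R)"
      proof
        fix y assume "y \<in> (\<Union>x\<in>F. ball x d)"
        then obtain x where "x \<in> F" "norm (x - y) < d" by (auto simp: dist_norm)
        moreover have "norm x \<le> R" using \<open>x \<in> F\<close> F by auto
        ultimately show "y \<in> cball 0 (1 + R)"
          using d1 norm_triangle_sub[of y x] by (auto simp: norm_minus_commute)
      qed
      show "(\<Union>x\<in>F. ball x d) \<in> sets lborel" using F by auto
      show "cball (0::'a) (1 + R) \<in> fmeasurable lborel"
        using emeasure_lborel_cball_finite[of "0::'a" "1 + R"] by (auto simp: fmeasurable_def)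
    qed
    also have "\<dots> = unit_ball_vol ?n * (1 + R) ^ ?n" using R by (simp add: content_cball)
    finally have "real (card F) * d ^ ?n \<le> (1 + R) ^ ?n"
      using unit_ball_vol_pos[of "real ?n"] by (simp add: mult.left_commute)
    then have "real (card F) \<le> ((1 + R) / d) ^ ?n"
      using d by (simp add: power_divide le_divide_eq)
    also have "(1 + R) / d = (2 / c) * (1 + R) ^ (N + 1)" by (simp add: d_def)
    also have "\<dots> ^ ?n = (2 / c) ^ ?n * (1 + R) ^ ((N + 1) * ?n)"
      by (simp only: power_mult_distrib power_mult)
    finally show ?thesis .
  qed
  then show ?thesis using c
    by (intro exI[of _ "(2 / c) ^ ?n"] exI[of _ "(N + 1) * ?n"]) auto
qed

text \<open>The packing bound counts finite subsets because \<open>card\<close> of an infinite set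
  is 0; a common bound for all finite subsets then forces finiteness.\<close>

lemma p_discrete_locally_finite:
  fixes S :: "'a::euclidean_space set"
  assumes "p_discrete S" shows "locally_finite S"
  unfolding locally_finite_def
proof (intro allI)
  fix x :: 'a and r :: real
  obtain A M where A: "\<forall>R\<ge>0. \<forall>F. finite F \<and> F \<subseteq> S \<inter> cball 0 R \<longrightarrow> real (card F) \<le> A * (1 + R) ^ M"
    using p_discrete_card[OF assms] by blast
  let ?R = "norm x + \<bar>r\<bar>"
  have "card F \<le> nat \<lfloor>A * (1 + ?R) ^ M\<rfloor>" if "F \<subseteq> S \<inter> cball 0 ?R" "finite F" for F
    using A[rule_format, of ?R F] that by (simp add: le_nat_floor)
  then have "finite (S \<inter> cball 0 ?R)" using finite_if_finite_subsets_card_bdd by blast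
  moreover have "ball x r \<subseteq> cball 0 ?R"
  proof
    fix y assume "y \<in> ball x r"
    then show "y \<in> cball 0 ?R"
      using norm_triangle_sub[of y x] by (auto simp: dist_norm norm_minus_commute)
  qed
  ultimately show "finite (S \<inter> ball x r)" by (meson Int_mono finite_subset order_refl)
qed

text \<open>Group the points by the integer part \<open>n\<close> of their norm. A shell holds at
  most about \<open>n ^ M\<close> points and the weight grows at most like \<open>n ^ N\<close>;
  dividing by the power \<open>N + M + 2\<close> leaves the summable
  \<open>1 / n ^ 2\<close>.\<close>

lemma p_discrete_moderate_sum:
  fixes S :: "'a::euclidean_space set"
  assumes S: "p_discrete S" and w: "moderate w"
  shows "\<exists>C K. 0 \<le> C \<and> (\<forall>F. finite F \<and> F \<subseteq> S \<longrightarrow> (\<Sum>x\<in>F. w x / (1 + norm x) ^ K) \<le> C)"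
proof -
  obtain A M where A: "0 < A"
    and card: "\<forall>R\<ge>0. \<forall>F. finite F \<and> F \<subseteq> S \<inter> cball 0 R \<longrightarrow> real (card F) \<le> A * (1 + R) ^ M"
    using p_discrete_card[OF S] by blast
  obtain C N where C: "C > 0" and wC: "\<And>x. w x \<le> C * (1 + norm x) ^ N"
    using moderate_dominated[OF w] by blast
  define z where "z n = inverse (real (Suc n) ^ 2)" for n
  have z: "summable z"
    unfolding z_def[abs_def] using inverse_power_summable[of 2, where 'a = real] by (subst summable_Suc_iff) simp
  \<comment> \<open>The factor \<open>2 ^ M\<close> comes from
    \<open>1 + (n + 1) \<le> 2 * Suc n\<close> in the count of the shell \<open>n\<close>.\<close>
  define B where "B = A * 2 ^ M * C"
  have B: "B > 0" using A C by (simp add: B_def)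
  define l where "l x = nat \<lfloor>norm x\<rfloor>" for x :: 'a
  have l: "real (l x) \<le> norm x" "norm x \<le> real (l x) + 1" for x
    unfolding l_def using norm_ge_zero[of x] by linarith+
  have "(\<Sum>x\<in>F. w x / (1 + norm x) ^ (N + M + 2)) \<le> B * suminf z" if F: "finite F" "F \<subseteq> S" for F
  proof -
    have "(\<Sum>x\<in>F. w x / (1 + norm x) ^ (N + M + 2)) \<le> (\<Sum>x\<in>F. C / real (Suc (l x)) ^ (M + 2))"
    proof (rule sum_mono)
      fix x :: 'a
      have p: "(1 + norm x) ^ k > 0" for k by (simp add: add_pos_nonneg)
      have "w x / (1 + norm x) ^ (N + M + 2) \<le> C * (1 + norm x) ^ N / (1 + norm x) ^ (N + M + 2)"
        using wC by (intro divide_right_mono) auto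
      also have "\<dots> = C / (1 + norm x) ^ (M + 2)"
      proof -
        have "(1 + norm x) ^ (N + M + 2) = (1 + norm x) ^ (M + 2) * (1 + norm x) ^ N"
          by (simp only: power_add mult_ac)
        then show ?thesis
          by (simp only: mult_divide_mult_cancel_right[OF less_imp_neq[OF p, symmetric]])
      qed
      also have "\<dots> \<le> C / real (Suc (l x)) ^ (M + 2)"
        using l(1)[of x] C p by (intro divide_left_mono power_mono mult_pos_pos zero_less_power) auto
      finally show "w x / (1 + norm x) ^ (N + M + 2) \<le> C / real (Suc (l x)) ^ (M + 2)" .
    qed
    also have "\<dots> = (\<Sum>n\<in>l ` F. \<Sum>x\<in>{x \<in> F. l x = n}. C / real (Suc (l x)) ^ (M + 2))"
      by (rule sum.image_gen[OF F(1)])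
    also have "\<dots> \<le> (\<Sum>n\<in>l ` F. B * z n)"
    proof (rule sum_mono)
      fix n
      have "real (card {x \<in> F. l x = n}) \<le> A * (1 + (real n + 1)) ^ M"
        using F l(2) by (intro card[rule_format]) auto
      also have "\<dots> \<le> A * (2 * real (Suc n)) ^ M"
        using A by (intro mult_left_mono power_mono) auto
      finally have "real (card {x \<in> F. l x = n}) * (C / real (Suc n) ^ (M + 2))
          \<le> A * (2 * real (Suc n)) ^ M * (C / real (Suc n) ^ (M + 2))"
        using C by (intro mult_right_mono) auto
      also have "\<dots> = B * z n"
        by (simp add: B_def z_def power_mult_distrib power_add power2_eq_square field_simps del: of_nat_Suc)
      finally show "(\<Sum>x\<in>{x \<in> F. l x = n}. C / real (Suc (l x)) ^ (M + 2)) \<le> B * z n" by simp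
    qed
    also have "\<dots> = B * (\<Sum>n\<in>l ` F. z n)" by (simp add: sum_distrib_left)
    also have "\<dots> \<le> B * suminf z"
      using B F by (intro mult_left_mono sum_le_suminf z) (auto simp: z_def)
    finally show ?thesis .
  qed
  moreover have "0 \<le> suminf z" by (intro suminf_nonneg z) (auto simp: z_def)
  ultimately show ?thesis using B by (intro exI[of _ "B * suminf z"] exI[of _ "N + M + 2"]) auto
qed

text \<open>The required distribution is the sum \<open>g\<close> over all atoms. Choosing
  \<open>K\<close> so that the weighted atoms are summable makes \<open>g\<close> absolutely
  convergent and bounded by two seminorms of order zero, whence its continuity.\<close>

lemma tempered_measure_variation:
  fixes \<mu> :: "'a::euclidean_space set \<Rightarrow> complex"
  assumes \<mu>: "complex_measure \<mu>" and S: "p_discrete (measure_support \<mu>)"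
    and mod: "moderate (\<lambda>x. norm (\<mu> {x}))"
  shows "tempered_measure (variation \<mu>)"
proof -
  let ?S = "measure_support \<mu>"
  have lf: "locally_finite ?S" by (rule p_discrete_locally_finite[OF S])
  have v: "discrete_on ?S (\<lambda>x. complex_of_real (norm (\<mu> {x}))) (variation \<mu>)"
    by (intro variation_discrete lf measure_support_closed complex_measure_discrete \<mu>)
  define g where "g \<phi> = (\<Sum>\<^sub>\<infinity>x\<in>?S. of_real (norm (\<mu> {x})) * \<phi> x)" for \<phi> :: "'a \<Rightarrow> complex"
  obtain C K where C: "0 \<le> C" and CK: "\<And>F. finite F \<Longrightarrow> F \<subseteq> ?S \<Longrightarrow> (\<Sum>x\<in>F. norm (\<mu> {x}) / (1 + norm x) ^ K) \<le> C"
    using p_discrete_moderate_sum[OF S mod] by blast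
  let ?p = "\<lambda>\<phi>. schwartz_seminorm 0 [] \<phi> + schwartz_seminorm K [] \<phi>"
  \<comment> \<open>The two seminorms together control the weight \<open>(1 + norm x) ^ K\<close>,
    since \<open>(1 + t) ^ K \<le> 2 ^ K * (1 + t ^ K)\<close> for \<open>t \<ge> 0\<close>: compare
    with \<open>2 ^ K\<close> for \<open>t \<le> 1\<close> and with \<open>(2 * t) ^ K\<close>
    otherwise.\<close>
  have decay: "norm (\<phi> x) \<le> 2 ^ K * ?p \<phi> / (1 + norm x) ^ K" if "\<phi> \<in> schwartz" for \<phi> and x :: 'a
  proof -
    have "(1 + norm x) ^ K \<le> 2 ^ K * (1 + norm x ^ K)"
    proof (cases "norm x \<le> 1")
      case True
      then have "(1 + norm x) ^ K \<le> 2 ^ K" by (intro power_mono) auto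
      also have "\<dots> \<le> 2 ^ K * (1 + norm x ^ K)" by simp
      finally show ?thesis .
    next
      case False
      then have "(1 + norm x) ^ K \<le> (2 * norm x) ^ K" by (intro power_mono) auto
      also have "\<dots> \<le> 2 ^ K * (1 + norm x ^ K)" by (simp add: power_mult_distrib)
      finally show ?thesis .
    qed
    then have "(1 + norm x) ^ K * norm (\<phi> x) \<le> 2 ^ K * (1 + norm x ^ K) * norm (\<phi> x)"
      by (intro mult_right_mono) auto
    also have "\<dots> = 2 ^ K * (norm x ^ 0 * norm (partials [] \<phi> x) + norm x ^ K * norm (partials [] \<phi> x))"
      by (simp add: algebra_simps)
    also have "\<dots> \<le> 2 ^ K * ?p \<phi>"
      by (intro mult_left_mono add_mono schwartz_seminorm_upper that) auto
    finally show ?thesis by (simp add: le_divide_eq mult.commute add_pos_nonneg)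
  qed
  have partial: "(\<Sum>x\<in>F. norm (of_real (norm (\<mu> {x})) * \<phi> x)) \<le> C * (2 ^ K * ?p \<phi>)"
    if "\<phi> \<in> schwartz" "finite F" "F \<subseteq> ?S" for \<phi> F
  proof -
    have "(\<Sum>x\<in>F. norm (of_real (norm (\<mu> {x})) * \<phi> x)) \<le> (\<Sum>x\<in>F. norm (\<mu> {x}) / (1 + norm x) ^ K * (2 ^ K * ?p \<phi>))"
    proof (rule sum_mono)
      fix x
      show "norm (of_real (norm (\<mu> {x})) * \<phi> x) \<le> norm (\<mu> {x}) / (1 + norm x) ^ K * (2 ^ K * ?p \<phi>)"
        using mult_left_mono[OF decay[OF that(1), of x], of "norm (\<mu> {x})"] by (simp add: norm_mult)
    qed
    also have "\<dots> = (\<Sum>x\<in>F. norm (\<mu> {x}) / (1 + norm x) ^ K) * (2 ^ K * ?p \<phi>)"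
      by (simp only: sum_distrib_right)
    also have "\<dots> \<le> C * (2 ^ K * ?p \<phi>)"
      using that schwartz_seminorm_nonneg[OF that(1) lists.Nil]
      by (intro mult_right_mono CK) auto
    finally show ?thesis .
  qed
  have abs_summable: "(\<lambda>x. norm (of_real (norm (\<mu> {x})) * \<phi> x)) summable_on ?S" if "\<phi> \<in> schwartz" for \<phi>
    by (rule nonneg_bdd_above_summable_on) (auto intro!: bdd_aboveI2 partial[OF that])
  note summable = abs_summable_summable[OF abs_summable]
  have g_bound: "norm (g \<phi>) \<le> C * 2 ^ K * ?p \<phi>" if "\<phi> \<in> schwartz" for \<phi>
  proof -
    have "norm (g \<phi>) \<le> (\<Sum>\<^sub>\<infinity>x\<in>?S. norm (of_real (norm (\<mu> {x})) * \<phi> x))"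
      unfolding g_def by (rule norm_infsum_bound[OF abs_summable[OF that]])
    also have "\<dots> \<le> C * (2 ^ K * ?p \<phi>)"
      by (rule infsum_le_finite_sums[OF abs_summable[OF that] partial[OF that]])
    finally show ?thesis by (simp add: mult.assoc)
  qed
  have g_add: "g (\<lambda>x. \<phi> x + \<psi> x) = g \<phi> + g \<psi>" if "\<phi> \<in> schwartz" "\<psi> \<in> schwartz" for \<phi> \<psi>
    unfolding g_def distrib_left by (rule infsum_add[OF summable[OF that(1)] summable[OF that(2)]])
  have g_scale: "g (\<lambda>x. c * \<phi> x) = c * g \<phi>" for c \<phi>
    unfolding g_def mult.left_commute[of _ c] by (rule infsum_cmult_right')
  define L where "L = C * 2 ^ K"
  have L: "0 \<le> L" using C by (simp add: L_def)
  have "continuous_map schwartz_topology euclidean g"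
    unfolding continuous_map_def
  proof (intro conjI allI impI)
    fix V :: "complex set" assume "openin euclidean V"
    then have V: "open V" by simp
    show "openin schwartz_topology {\<phi> \<in> topspace schwartz_topology. g \<phi> \<in> V}" (is "openin _ ?W")
    proof (subst openin_subopen, rule ballI)
      fix \<phi> assume "\<phi> \<in> ?W"
      then have \<phi>: "\<phi> \<in> schwartz" "g \<phi> \<in> V" by (auto simp: topspace_schwartz)
      obtain e where e: "e > 0" "ball (g \<phi>) e \<subseteq> V" using V \<phi>(2) open_contains_ball by blast
      \<comment> \<open>The 2 accounts for the two seminorms; \<open>L + 1\<close> avoids division
        by zero when \<open>L = 0\<close> and makes the final estimate strict.\<close>
      define d where "d = e / (2 * (L + 1))"
      have d: "d > 0" using e L by (simp add: d_def)
      have Ld: "L * (2 * d) < e"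
      proof -
        have "(L + 1) * (2 * d) = e" using L by (simp add: d_def field_simps)
        then show ?thesis using d by (simp add: algebra_simps)
      qed
      let ?T = "{\<psi> \<in> schwartz. schwartz_seminorm 0 [] (\<lambda>x. \<psi> x - \<phi> x) < d}
        \<inter> {\<psi> \<in> schwartz. schwartz_seminorm K [] (\<lambda>x. \<psi> x - \<phi> x) < d}"
      have "openin schwartz_topology ?T"
        by (intro openin_Int openin_schwartz_seminorm \<phi> d lists.Nil)
      moreover have "\<phi> \<in> ?T" using \<phi> d by (simp add: schwartz_seminorm_zero)
      moreover have "?T \<subseteq> ?W"
      proof
        fix \<psi> assume \<psi>: "\<psi> \<in> ?T"
        then have \<psi>s: "\<psi> \<in> schwartz" by simp
        let ?\<delta> = "\<lambda>x. \<psi> x - \<phi> x"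
        have \<delta>: "?\<delta> \<in> schwartz" by (rule schwartz_diff[OF \<psi>s \<phi>(1)])
        have "g \<psi> = g \<phi> + g ?\<delta>" using g_add[OF \<phi>(1) \<delta>] by simp
        moreover have "norm (g ?\<delta>) < e"
        proof -
          have "norm (g ?\<delta>) \<le> L * ?p ?\<delta>" using g_bound[OF \<delta>] by (simp add: L_def)
          also have "\<dots> \<le> L * (2 * d)" using \<psi> by (intro mult_left_mono L) auto
          finally show ?thesis using Ld by linarith
        qed
        ultimately have "g \<psi> \<in> ball (g \<phi>) e" by (simp add: dist_norm)
        then show "\<psi> \<in> ?W" using e \<psi>s by (auto simp: topspace_schwartz)
      qed
      ultimately show "\<exists>T. openin schwartz_topology T \<and> \<phi> \<in> T \<and> T \<subseteq> ?W" by blast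
    qed
  qed simp
  then have "tempered_distribution g"
    unfolding tempered_distribution_def using g_add g_scale by blast
  moreover have "is_measure g (variation \<mu>)"
    unfolding is_measure_def
  proof (intro conjI allI impI)
    show "complex_measure (variation \<mu>)" by (rule discrete_on_complex_measure[OF lf v])
    fix \<phi> :: "'a \<Rightarrow> complex" assume \<phi>: "test_function \<phi>"
    let ?F = "closure {x. \<phi> x \<noteq> 0} \<inter> ?S"
    have fin: "finite ?F"
      using \<phi> by (intro locally_finite_Int_bounded[OF lf] compact_imp_bounded) (simp add: test_function_def)
    have out: "x \<in> ?F" if "x \<in> ?S" "\<phi> x \<noteq> 0" for x
      using that closure_subset[of "{x. \<phi> x \<noteq> 0}"] by blast
    \<comment> \<open>On a test function the infinite sum collapses to the finitely many atoms in
      its support, where it can be compared with \<open>complex_integral\<close>.\<close>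
    have "g \<phi> = (\<Sum>\<^sub>\<infinity>x\<in>?F. of_real (norm (\<mu> {x})) * \<phi> x)"
      unfolding g_def using out by (intro infsum_cong_neutral) auto
    also have "\<dots> = (\<Sum>x\<in>?F. of_real (norm (\<mu> {x})) * \<phi> x)" by (rule infsum_finite[OF fin])
    also have "\<dots> = complex_integral (variation \<mu>) \<phi>"
    proof (rule complex_integral_discrete[symmetric, OF lf v _ fin])
      show "\<phi> \<in> borel_measurable borel"
        using \<phi> by (intro borel_measurable_continuous_onI smooth_continuous_on) (simp add: test_function_def)
    qed (use out in auto)
    finally show "g \<phi> = complex_integral (variation \<mu>) \<phi>" .
  qed
  ultimately show ?thesis unfolding tempered_measure_def by blast
qed

subsection \<open>Size of the atoms\<close>

context cutoff_radius
begin

definition bump :: "'a \<Rightarrow> 'a \<Rightarrow> complex" where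
  "bump x y = of_real (flat 0 (1 - (y - x) \<bullet> (y - x) / (\<epsilon> x)\<^sup>2))"

lemma bump_self: "bump x x = of_real (exp (- 1))"
  by (simp add: bump_def flat_def)

lemma bump_outside: "\<epsilon> x \<le> norm (y - x) \<Longrightarrow> bump x y = 0"
proof -
  assume "\<epsilon> x \<le> norm (y - x)"
  then have "(\<epsilon> x)\<^sup>2 \<le> (norm (y - x))\<^sup>2" using radius_pos[of x] by (intro power_mono) auto
  then have "1 \<le> (y - x) \<bullet> (y - x) / (\<epsilon> x)\<^sup>2"
    using radius_pos[of x] by (simp add: power2_norm_eq_inner le_divide_eq)
  then show ?thesis by (simp add: bump_def flat_def)
qed

lemma bump_in_bump_families: "bump \<in> bump_families"
  unfolding bump_families_def
proof (intro CollectI conjI allI impI)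
  show "bump \<in> cutoff_algebra \<epsilon>" unfolding bump_def[abs_def] by (rule cutoff_algebra.cut)
  show "bump x y = 0" if "1 < norm (y - x)" for x y
    using that radius_le_1[of x] by (intro bump_outside) auto
qed

lemma bump_support: "closure {y. bump x y \<noteq> 0} \<subseteq> cball x (\<epsilon> x)"
proof (rule closure_minimal)
  show "{y. bump x y \<noteq> 0} \<subseteq> cball x (\<epsilon> x)"
    using bump_outside[of x] by (force simp: dist_norm norm_minus_commute)
qed simp

lemma bump_test_function: "test_function (bump x)"
  unfolding test_function_def
proof (intro conjI bump_smooth bump_in_bump_families)
  show "compact (closure {y. bump x y \<noteq> 0})"
    using bounded_subset[OF bounded_cball bump_support[of x]] by (simp add: compact_eq_bounded_closed)
qed

text \<open>The radius isolates \<open>x\<close>, so the integral keeps the single term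
  \<open>\<mu> {x} * bump x x\<close>, and the factor \<open>exp 1\<close> undoes the central value
  \<open>exp (- 1)\<close>. A distance equal to \<open>\<epsilon> x\<close> is harmless, since the
  bump vanishes there.\<close>

lemma bump_evaluates_atom:
  assumes f: "is_measure f \<mu>" and S: "locally_finite (measure_support \<mu>)"
    and x: "x \<in> measure_support \<mu>"
    and sep: "\<And>y. y \<in> measure_support \<mu> \<Longrightarrow> y \<noteq> x \<Longrightarrow> \<epsilon> x \<le> norm (y - x)"
  shows "\<mu> {x} = of_real (exp 1) * f (bump x)"
proof -
  have \<mu>: "complex_measure \<mu>" using f by (simp add: is_measure_def)
  have "f (bump x) = complex_integral \<mu> (bump x)"
    using f bump_test_function by (simp add: is_measure_def)
  also have "\<dots> = (\<Sum>y\<in>{x}. \<mu> {y} * bump x y)"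
  proof (rule complex_integral_discrete[OF S complex_measure_discrete[OF \<mu> S]])
    show "bump x \<in> borel_measurable borel"
      by (intro borel_measurable_continuous_onI bump_continuous bump_in_bump_families)
    show "y \<in> {x}" if "y \<in> measure_support \<mu>" "bump x y \<noteq> 0" for y
      using sep[OF that(1)] bump_outside that(2) by blast
  qed (use x in auto)
  finally show ?thesis by (simp add: bump_self exp_minus flip: of_real_mult exp_of_real)
qed

end

text \<open>The separation of the support supplies the radius. The growth of \<open>f\<close> on
  bumps is left as a hypothesis so that the lemma serves both a tempered distribution and the
  Fourier transform of one.\<close>

lemma moderate_atoms:
  assumes f: "is_measure f \<mu>" and S: "p_discrete (measure_support \<mu>)"
    and bound: "\<And>\<epsilon>. cutoff_radius \<epsilon> \<Longrightarrow> moderate (\<lambda>x. norm (f (cutoff_radius.bump \<epsilon> x)))"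
  shows "moderate (\<lambda>x. norm (\<mu> {x}))"
proof -
  let ?S = "measure_support \<mu>"
  have lf: "locally_finite ?S" by (rule p_discrete_locally_finite[OF S])
  have \<mu>: "complex_measure \<mu>" using f by (simp add: is_measure_def)
  obtain c N where c: "0 < c" "c \<le> 1" and
    sep: "\<And>x x'. x \<in> ?S \<Longrightarrow> x' \<in> ?S \<Longrightarrow> x \<noteq> x' \<Longrightarrow> c / (1 + norm x) ^ N \<le> norm (x - x')"
    using p_discrete_separation[OF S] by blast
  define \<epsilon> where "\<epsilon> x = c / (1 + norm x) ^ N" for x :: 'a
  have "cutoff_radius \<epsilon>"
  proof
    show "0 < \<epsilon> x" for x using c by (simp add: \<epsilon>_def add_pos_nonneg)
    show "\<epsilon> x \<le> 1" for x
      unfolding \<epsilon>_def divide_le_eq_1 using one_le_one_plus_norm_power[of x N] c by linarith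
    show "moderate (\<lambda>x. 1 / \<epsilon> x)" by (rule moderateI[of _ "1 / c" N]) (simp add: \<epsilon>_def)
  qed
  then interpret cutoff_radius \<epsilon> .
  have "norm (\<mu> {x}) \<le> exp 1 * norm (f (bump x))" for x
  proof (cases "x \<in> ?S")
    case True
    have "\<mu> {x} = of_real (exp 1) * f (bump x)"
      by (rule bump_evaluates_atom[OF f lf True])
        (use sep[OF True] in \<open>force simp: \<epsilon>_def norm_minus_commute\<close>)
    then show ?thesis by (simp add: norm_mult del: of_real_exp)
  next
    case False
    then show ?thesis using complex_measure_null_off_support[OF \<mu>, of "{x}"] by simp
  qed
  moreover have "moderate (\<lambda>x. exp 1 * norm (f (bump x)))"
    by (intro moderate_mult moderate_const bound \<open>cutoff_radius \<epsilon>\<close>) auto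
  ultimately show ?thesis by (rule moderate_mono[rotated])
qed

text \<open>Links p-discreteness of the distributional support to the support of the representing
  measure. If \<open>f\<close> vanishes near \<open>x\<close>, a small bump shows that the atom at
  \<open>x\<close> is 0, and then \<open>\<mu>\<close> vanishes on a whole ball about
  \<open>x\<close>.\<close>

lemma measure_support_subset_dist_support:
  assumes f: "is_measure f \<mu>" and S: "locally_finite (measure_support \<mu>)"
  shows "measure_support \<mu> \<subseteq> dist_support f"
proof
  let ?S = "measure_support \<mu>"
  have \<mu>: "complex_measure \<mu>" using f by (simp add: is_measure_def)
  fix x assume x: "x \<in> ?S"
  show "x \<in> dist_support f"
  proof (rule ccontr)
    assume "x \<notin> dist_support f"
    then obtain U where U: "open U" "x \<in> U"
      and fU: "\<And>\<phi>. test_function \<phi> \<Longrightarrow> closure {x. \<phi> x \<noteq> 0} \<subseteq> U \<Longrightarrow> f \<phi> = 0"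
      unfolding dist_support_def by blast
    obtain r1 where r1: "r1 > 0" "cball x r1 \<subseteq> U" using U open_contains_cball by blast
    have "finite (?S \<inter> ball x 1)" using S by (simp add: locally_finite_def)
    then obtain r2 where r2: "r2 > 0" "\<And>y. y \<in> ?S \<inter> ball x 1 \<Longrightarrow> y \<noteq> x \<Longrightarrow> r2 \<le> dist x y"
      using finite_set_avoid[of "?S \<inter> ball x 1" x] by blast
    \<comment> \<open>1 is the largest admissible radius and stays in the ball where finiteness was
      used, \<open>r1\<close> keeps the bump inside \<open>U\<close>, and \<open>r2\<close>
      separates \<open>x\<close> from the other points of the support.\<close>
    define r where "r = min 1 (min r1 r2)"
    have r: "0 < r" "r \<le> 1" "r \<le> r1" "r \<le> r2" using r1 r2 by (auto simp: r_def)
    have sep: "r \<le> norm (y - x)" if "y \<in> ?S" "y \<noteq> x" for y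
      using r2(2)[of y] that r by (cases "y \<in> ball x 1") (auto simp: dist_norm norm_minus_commute)
    \<comment> \<open>A constant radius is trivially moderate, so the same bumps serve this purely
      local argument.\<close>
    interpret cutoff_radius "\<lambda>_. r"
      using r by unfold_locales (auto simp: moderate_const)
    have "f (bump x) = 0"
      using bump_support[of x] r1(2) r(3) by (intro fU bump_test_function) force
    then have atom: "\<mu> {x} = 0" using bump_evaluates_atom[OF f S x sep] by simp
    have "\<mu> E = 0" if E: "E \<in> sets borel" "bounded E" "E \<subseteq> ball x r" for E
    proof -
      have "E \<inter> ?S \<subseteq> {x}" using E(3) sep by (force simp: dist_norm norm_minus_commute)
      then have "(\<Sum>y\<in>E \<inter> ?S. \<mu> {y}) = 0" using atom by (intro sum.neutral) auto
      then show ?thesis using discrete_onD[OF complex_measure_discrete[OF \<mu> S] E(1,2)] by simp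
    qed
    then have "x \<notin> ?S"
      unfolding measure_support_def using r(1) by (auto intro!: exI[of _ "ball x r"])
    then show False using x by simp
  qed
qed

lemma p_discrete_subset: "p_discrete S \<Longrightarrow> T \<subseteq> S \<Longrightarrow> p_discrete T"
  unfolding p_discrete_def by (meson subsetD)

text \<open>The second bound applies \<open>f\<close> to the transforms of the bumps, whose
  seminorms are moderate by \<open>bump_fourier_schwartz\<close>; continuity is used for
  \<open>f\<close> alone.\<close>

lemma tempered_moderate_bump:
  assumes "tempered_distribution f" "cutoff_radius \<epsilon>"
  shows "moderate (\<lambda>x. norm (f (cutoff_radius.bump \<epsilon> x)))"
    and "moderate (\<lambda>x. norm (dist_fourier f (cutoff_radius.bump \<epsilon> x)))"
proof -
  interpret cutoff_radius \<epsilon> by fact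
  show "moderate (\<lambda>x. norm (f (bump x)))"
    by (intro tempered_distribution_moderate assms(1) bump_schwartz bump_in_bump_families)
  show "moderate (\<lambda>x. norm (dist_fourier f (bump x)))"
    unfolding dist_fourier_def
    by (intro tempered_distribution_moderate assms(1) bump_fourier_schwartz bump_in_bump_families)
qed

theorem theorem8:
  "(\<forall>\<mu> :: (real ^ 'd) set \<Rightarrow> complex.
      complex_measure \<mu> \<and> p_discrete (measure_support \<mu>) \<and> tempered_measure \<mu>
        \<longrightarrow> tempered_measure (variation \<mu>)) \<and>
   (\<forall>f :: (real ^ 'd \<Rightarrow> complex) \<Rightarrow> complex.
      crystalline_measure f \<and> p_discrete (dist_support f) \<and> p_discrete (spectrum f)
        \<longrightarrow> fourier_quasicrystal f)"
proof (intro conjI allI impI; elim conjE)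
  fix \<mu> :: "(real ^ 'd) set \<Rightarrow> complex"
  assume \<mu>: "complex_measure \<mu>" "p_discrete (measure_support \<mu>)" "tempered_measure \<mu>"
  then obtain f where f: "tempered_distribution f" "is_measure f \<mu>"
    unfolding tempered_measure_def by blast
  show "tempered_measure (variation \<mu>)"
    by (intro tempered_measure_variation \<mu> moderate_atoms[OF f(2)] tempered_moderate_bump f)
next
  fix f :: "(real ^ 'd \<Rightarrow> complex) \<Rightarrow> complex"
  assume "crystalline_measure f" and pf: "p_discrete (dist_support f)" "p_discrete (spectrum f)"
  then obtain \<mu> \<nu> where f: "tempered_distribution f"
    and \<mu>: "is_measure f \<mu>" "locally_finite (measure_support \<mu>)"
    and \<nu>: "is_measure (dist_fourier f) \<nu>" "locally_finite (measure_support \<nu>)"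
    unfolding crystalline_measure_def by blast
  have cm: "complex_measure \<mu>" "complex_measure \<nu>" using \<mu> \<nu> by (auto simp: is_measure_def)
  have p\<mu>: "p_discrete (measure_support \<mu>)"
    by (rule p_discrete_subset[OF pf(1) measure_support_subset_dist_support[OF \<mu>]])
  have p\<nu>: "p_discrete (measure_support \<nu>)"
    using p_discrete_subset[OF pf(2)] measure_support_subset_dist_support[OF \<nu>] by (simp add: spectrum_def)
  have "locally_finite (measure_support (variation \<mu>))" "locally_finite (measure_support (variation \<nu>))"
    using measure_support_variation_subset[OF cm(1) \<mu>(2)] measure_support_variation_subset[OF cm(2) \<nu>(2)] \<mu>(2) \<nu>(2)
    unfolding locally_finite_def by (meson Int_mono finite_subset order_refl)+
  moreover have "tempered_measure (variation \<mu>)"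
    by (intro tempered_measure_variation cm p\<mu> moderate_atoms[OF \<mu>(1)] tempered_moderate_bump(1) f)
  \<comment> \<open>Here the atoms are estimated through \<open>f (fourier (bump x))\<close>;
    \<open>dist_fourier f\<close> is not asked to be a tempered distribution itself.\<close>
  moreover have "tempered_measure (variation \<nu>)"
    by (intro tempered_measure_variation cm p\<nu> moderate_atoms[OF \<nu>(1)] tempered_moderate_bump(2) f)
  ultimately show "fourier_quasicrystal f"
    unfolding fourier_quasicrystal_def using f \<mu>(1) \<nu>(1) by blast
qed

end
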